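(* Let $(P,\triangleleft^{f})$ be a gauge quandle (discrete, topological or smooth) with underlying principal bundle $\pi:P\to M$ and structure group $G$. Then for every $m\in M$ the fiber quandle $(\pi^{-1}(m),\triangleleft^{f})$ is isomorphic, as a quandle (respectively as a topological quandle, as a smooth quandle), to the generalized Alexander quandle of $G$ for some inner automorphism of $G$.
   Context: A quandle is a set $X$ with a binary operation $\triangleleft$ such that $(x\triangleleft y)\triangleleft z=(x\triangleleft z)\triangleleft(y\triangleleft z)$ and $x\triangleleft x=x$ for all $x,y,z\in X$, and each map $-\triangleleft x:X\to X$ is bijective. It is a topological (resp. smooth) quandle if $X$ is a topological space (resp. smooth manifold) and $\triangleleft$ is continuous (resp. smooth). A quandle isomorphism is a bijection $F$ with $F(x_1\triangleleft x_2)=F(x_1)\triangleleft F(x_2)$; between topological (resp. smooth) quandles it is required to be a homeomorphism (resp. diffeomorphism). Let $P,M$ be sets and $G$ a group. $P$ is a discrete principal bundle over $M$ with structure group $G$ if there are a surjective map $\pi:P\to M$ and a right action $P\times G\to P$, $(p,g)\mapsto p\cdot g$, such that: for each $m\in M$ there is a bijection $\psi_m:\pi^{-1}(m)\to G$; $\pi(p\cdot g)=\pi(p)$; $G$ acts freely and transitively on each fiber $\pi^{-1}(m)$; and $\psi_m(p\cdot g)=\psi_m(p)g$ for $p\in\pi^{-1}(m)$, $g\in G$. In the topological (resp. smooth) case, $P\to M$ is an ordinary locally trivial principal bundle of topological spaces with $G$ a topological group (resp. a smooth principal bundle with $G$ a Lie group). Given $f:P\to G$ with $f(p\cdot g)=g^{-1}f(p)g$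 for all $p\in P$, $g\in G$ ($f$ an arbitrary map in the discrete case, continuous in the topological case, smooth in the smooth case), the gauge quandle $(P,\triangleleft^f)$ is $P$ with the operation $p_1\triangleleft^f p_2:=p_1\cdot (f(p_1)^{-1}f(p_2))$. For $m\in M$, the fiber $\pi^{-1}(m)$ is closed under $\triangleleft^f$, and the subquandle $(\pi^{-1}(m),\triangleleft^f)$ is called the fiber quandle at $m$. For a group $G$ and $\sigma\in\mathrm{Aut}(G)$, the generalized Alexander quandle of $G$ for $\sigma$ is $G$ with the operation $g_1\triangleleft g_2:=\sigma(g_1g_2^{-1})g_2$. *)

theory Defs
  imports "HOL-Analysis.Analysis" "HOL-Algebra.Bij"
begin

section \<open>Smooth manifolds\<close>

text \<open>
  The space of real \<open>n\<close>-tuples is the library's \<^const>\<open>Euclidean_space\<close> \<open>n\<close>: sequences whose entries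
  at positions \<open>\<ge> n\<close> vanish. The dimension is thus a natural number and may be 0, so that
  discrete Lie groups and bundles over a point are not excluded.
\<close>

definition partial_deriv :: "nat \<Rightarrow> ((nat \<Rightarrow> real) \<Rightarrow> real) \<Rightarrow> (nat \<Rightarrow> real) \<Rightarrow> real" where
  "partial_deriv i h x = deriv (\<lambda>t. h (x(i := t))) (x i)"

text \<open>\<open>C_diff n k U h\<close>: all partial derivatives of \<open>h\<close> of order up to \<open>k\<close> exist and are continuous
  on \<open>U\<close>, where \<open>U\<close> is meant to be open in \<open>Euclidean_space n\<close>.\<close>

primrec C_diff :: "nat \<Rightarrow> nat \<Rightarrow> (nat \<Rightarrow> real) set \<Rightarrow> ((nat \<Rightarrow> real) \<Rightarrow> real) \<Rightarrow> bool" where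
  "C_diff n 0 U h \<longleftrightarrow> continuous_map (subtopology (Euclidean_space n) U) euclideanreal h"
| "C_diff n (Suc k) U h \<longleftrightarrow>
     continuous_map (subtopology (Euclidean_space n) U) euclideanreal h \<and>
     (\<forall>i<n. (\<forall>x\<in>U. (\<lambda>t. h (x(i := t))) field_differentiable at (x i)) \<and>
            C_diff n k U (partial_deriv i h))"

definition smooth_euclidean ::
    "nat \<Rightarrow> nat \<Rightarrow> (nat \<Rightarrow> real) set \<Rightarrow> ((nat \<Rightarrow> real) \<Rightarrow> (nat \<Rightarrow> real)) \<Rightarrow> bool" where
  "smooth_euclidean n m U F \<longleftrightarrow> (\<forall>j<m. \<forall>k. C_diff n k U (\<lambda>x. F x j))"

text \<open>A chart is a pair \<open>(U, c)\<close>; only the values of \<open>c\<close> on \<open>U\<close> matter.\<close>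

record 'a mfd =
  mtop :: "'a topology"
  mdim :: nat
  charts :: "('a set \<times> ('a \<Rightarrow> nat \<Rightarrow> real)) set"

definition is_chart :: "nat \<Rightarrow> 'a topology \<Rightarrow> 'a set \<Rightarrow> ('a \<Rightarrow> nat \<Rightarrow> real) \<Rightarrow> bool" where
  "is_chart n X U c \<longleftrightarrow>
     openin X U \<and> openin (Euclidean_space n) (c ` U) \<and>
     homeomorphic_map (subtopology X U) (subtopology (Euclidean_space n) (c ` U)) c"

text \<open>The atlas is not required to be maximal; smoothness of maps does not depend on this.\<close>

definition smooth_manifold :: "'a mfd \<Rightarrow> bool" where
  "smooth_manifold A \<longleftrightarrow>
     Hausdorff_space (mtop A) \<and> second_countable (mtop A) \<and>
     (\<forall>(U, c) \<in> charts A. is_chart (mdim A) (mtop A) U c) \<and>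
     (\<Union>(U, c) \<in> charts A. U) = topspace (mtop A) \<and>
     (\<forall>(U, c) \<in> charts A. \<forall>(V, d) \<in> charts A.
        smooth_euclidean (mdim A) (mdim A) (c ` (U \<inter> V)) (d \<circ> inv_into U c))"

definition smooth_map :: "'a mfd \<Rightarrow> 'b mfd \<Rightarrow> ('a \<Rightarrow> 'b) \<Rightarrow> bool" where
  "smooth_map A B F \<longleftrightarrow>
     continuous_map (mtop A) (mtop B) F \<and>
     (\<forall>(U, c) \<in> charts A. \<forall>(V, d) \<in> charts B.
        smooth_euclidean (mdim A) (mdim B) (c ` (U \<inter> F -` V)) (d \<circ> F \<circ> inv_into U c))"

definition diffeomorphism :: "'a mfd \<Rightarrow> 'b mfd \<Rightarrow> ('a \<Rightarrow> 'b) \<Rightarrow> bool" where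
  "diffeomorphism A B F \<longleftrightarrow>
     bij_betw F (topspace (mtop A)) (topspace (mtop B)) \<and>
     smooth_map A B F \<and> smooth_map B A (inv_into (topspace (mtop A)) F)"

definition euclidean_mfd :: "nat \<Rightarrow> (nat \<Rightarrow> real) mfd" where
  "euclidean_mfd n =
     \<lparr>mtop = Euclidean_space n, mdim = n, charts = {(topspace (Euclidean_space n), id)}\<rparr>"

definition open_submfd :: "'a mfd \<Rightarrow> 'a set \<Rightarrow> 'a mfd" where
  "open_submfd A W =
     \<lparr>mtop = subtopology (mtop A) W, mdim = mdim A, charts = (\<lambda>(U, c). (U \<inter> W, c)) ` charts A\<rparr>"

definition append_coords :: "nat \<Rightarrow> (nat \<Rightarrow> real) \<Rightarrow> (nat \<Rightarrow> real) \<Rightarrow> nat \<Rightarrow> real" where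
  "append_coords n x y = (\<lambda>i. if i < n then x i else y (i - n))"

definition prod_mfd :: "'a mfd \<Rightarrow> 'b mfd \<Rightarrow> ('a \<times> 'b) mfd" where
  "prod_mfd A B =
     \<lparr>mtop = prod_topology (mtop A) (mtop B),
      mdim = mdim A + mdim B,
      charts = {(U \<times> V, \<lambda>(x, y). append_coords (mdim A) (c x) (d y)) | U c V d.
                 (U, c) \<in> charts A \<and> (V, d) \<in> charts B}\<rparr>"

text \<open>
  The structure of a \<open>k\<close>-dimensional embedded submanifold on a subset \<open>S\<close> of a manifold \<open>A\<close>,
  following Milnor and Guillemin--Pollack: the topology is the subspace topology, and the charts
  are the diffeomorphisms from open subsets of \<open>S\<close> to open subsets of Euclidean space, where a map
  defined on a subset of \<open>A\<close> is called smooth if it extends, locally around every point, to a smooth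
  map on an open subset of \<open>A\<close>. The set \<open>S\<close> is a \<open>k\<close>-dimensional embedded submanifold of \<open>A\<close>
  precisely if the result satisfies \<^const>\<open>smooth_manifold\<close>, i.e. if these charts cover \<open>S\<close>.
\<close>

definition embedded_submfd :: "'a mfd \<Rightarrow> 'a set \<Rightarrow> nat \<Rightarrow> 'a mfd" where
  "embedded_submfd A S k =
     \<lparr>mtop = subtopology (mtop A) S,
      mdim = k,
      charts = {(U, c).
        is_chart k (subtopology (mtop A) S) U c \<and>
        smooth_map (open_submfd (euclidean_mfd k) (c ` U)) A (inv_into U c) \<and>
        (\<forall>x\<in>U. \<exists>W h. openin (mtop A) W \<and> x \<in> W \<and>
           smooth_map (open_submfd A W) (euclidean_mfd k) h \<and> (\<forall>y \<in> U \<inter> W. h y = c y))}\<rparr>"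


section \<open>Quandles\<close>

definition quandle :: "'a set \<Rightarrow> ('a \<Rightarrow> 'a \<Rightarrow> 'a) \<Rightarrow> bool" where
  "quandle X q \<longleftrightarrow>
     (\<forall>x\<in>X. \<forall>y\<in>X. q x y \<in> X) \<and>
     (\<forall>x\<in>X. \<forall>y\<in>X. \<forall>z\<in>X. q (q x y) z = q (q x z) (q y z)) \<and>
     (\<forall>x\<in>X. q x x = x) \<and>
     (\<forall>x\<in>X. bij_betw (\<lambda>y. q y x) X X)"

definition topological_quandle :: "'a topology \<Rightarrow> ('a \<Rightarrow> 'a \<Rightarrow> 'a) \<Rightarrow> bool" where
  "topological_quandle T q \<longleftrightarrow>
     quandle (topspace T) q \<and> continuous_map (prod_topology T T) T (\<lambda>(x, y). q x y)"

definition smooth_quandle :: "'a mfd \<Rightarrow> ('a \<Rightarrow> 'a \<Rightarrow> 'a) \<Rightarrow> bool" where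
  "smooth_quandle A q \<longleftrightarrow>
     smooth_manifold A \<and> quandle (topspace (mtop A)) q \<and>
     smooth_map (prod_mfd A A) A (\<lambda>(x, y). q x y)"

definition quandle_hom ::
    "'a set \<Rightarrow> ('a \<Rightarrow> 'a \<Rightarrow> 'a) \<Rightarrow> ('b \<Rightarrow> 'b \<Rightarrow> 'b) \<Rightarrow> ('a \<Rightarrow> 'b) \<Rightarrow> bool" where
  "quandle_hom X q r F \<longleftrightarrow> (\<forall>x\<in>X. \<forall>y\<in>X. F (q x y) = r (F x) (F y))"

definition quandle_isomorphic ::
    "'a set \<Rightarrow> ('a \<Rightarrow> 'a \<Rightarrow> 'a) \<Rightarrow> 'b set \<Rightarrow> ('b \<Rightarrow> 'b \<Rightarrow> 'b) \<Rightarrow> bool" where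
  "quandle_isomorphic X q Y r \<longleftrightarrow>
     quandle X q \<and> quandle Y r \<and> (\<exists>F. bij_betw F X Y \<and> quandle_hom X q r F)"

definition topological_quandle_isomorphic ::
    "'a topology \<Rightarrow> ('a \<Rightarrow> 'a \<Rightarrow> 'a) \<Rightarrow> 'b topology \<Rightarrow> ('b \<Rightarrow> 'b \<Rightarrow> 'b) \<Rightarrow> bool" where
  "topological_quandle_isomorphic S q T r \<longleftrightarrow>
     topological_quandle S q \<and> topological_quandle T r \<and>
     (\<exists>F. homeomorphic_map S T F \<and> quandle_hom (topspace S) q r F)"

definition smooth_quandle_isomorphic ::
    "'a mfd \<Rightarrow> ('a \<Rightarrow> 'a \<Rightarrow> 'a) \<Rightarrow> 'b mfd \<Rightarrow> ('b \<Rightarrow> 'b \<Rightarrow> 'b) \<Rightarrow> bool" where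
  "smooth_quandle_isomorphic A q B r \<longleftrightarrow>
     smooth_quandle A q \<and> smooth_quandle B r \<and>
     (\<exists>F. diffeomorphism A B F \<and> quandle_hom (topspace (mtop A)) q r F)"

definition gen_alexander :: "('g, 'c) monoid_scheme \<Rightarrow> ('g \<Rightarrow> 'g) \<Rightarrow> 'g \<Rightarrow> 'g \<Rightarrow> 'g" where
  "gen_alexander G \<sigma> g h = \<sigma> (g \<otimes>\<^bsub>G\<^esub> inv\<^bsub>G\<^esub> h) \<otimes>\<^bsub>G\<^esub> h"

text \<open>Elements of \<^const>\<open>auto\<close> \<open>G\<close> are bijective endomorphisms of \<open>G\<close>, undefined off the carrier.\<close>

definition inner_automorphism :: "('g, 'c) monoid_scheme \<Rightarrow> ('g \<Rightarrow> 'g) \<Rightarrow> bool" where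
  "inner_automorphism G \<sigma> \<longleftrightarrow>
     \<sigma> \<in> auto G \<and>
     (\<exists>a \<in> carrier G. \<forall>g \<in> carrier G. \<sigma> g = a \<otimes>\<^bsub>G\<^esub> g \<otimes>\<^bsub>G\<^esub> inv\<^bsub>G\<^esub> a)"


section \<open>Principal bundles\<close>

definition topological_group :: "('g, 'c) monoid_scheme \<Rightarrow> 'g topology \<Rightarrow> bool" where
  "topological_group G T \<longleftrightarrow>
     group G \<and> topspace T = carrier G \<and>
     continuous_map (prod_topology T T) T (\<lambda>(x, y). x \<otimes>\<^bsub>G\<^esub> y) \<and>
     continuous_map T T (\<lambda>x. inv\<^bsub>G\<^esub> x)"

definition lie_group :: "('g, 'c) monoid_scheme \<Rightarrow> 'g mfd \<Rightarrow> bool" where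
  "lie_group G A \<longleftrightarrow>
     group G \<and> smooth_manifold A \<and> topspace (mtop A) = carrier G \<and>
     smooth_map (prod_mfd A A) A (\<lambda>(x, y). x \<otimes>\<^bsub>G\<^esub> y) \<and>
     smooth_map A A (\<lambda>x. inv\<^bsub>G\<^esub> x)"

definition right_action :: "'p set \<Rightarrow> ('g, 'c) monoid_scheme \<Rightarrow> ('p \<Rightarrow> 'g \<Rightarrow> 'p) \<Rightarrow> bool" where
  "right_action P G act \<longleftrightarrow>
     (\<forall>p\<in>P. \<forall>g\<in>carrier G. act p g \<in> P) \<and>
     (\<forall>p\<in>P. act p \<one>\<^bsub>G\<^esub> = p) \<and>
     (\<forall>p\<in>P. \<forall>g\<in>carrier G. \<forall>h\<in>carrier G. act (act p g) h = act p (g \<otimes>\<^bsub>G\<^esub> h))"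

definition fiber :: "'p set \<Rightarrow> ('p \<Rightarrow> 'm) \<Rightarrow> 'm \<Rightarrow> 'p set" where
  "fiber P \<pi> m = {p \<in> P. \<pi> p = m}"

definition discrete_principal_bundle ::
    "'p set \<Rightarrow> 'm set \<Rightarrow> ('g, 'c) monoid_scheme \<Rightarrow> ('p \<Rightarrow> 'm) \<Rightarrow> ('p \<Rightarrow> 'g \<Rightarrow> 'p) \<Rightarrow> bool" where
  "discrete_principal_bundle P M G \<pi> act \<longleftrightarrow>
     group G \<and> \<pi> ` P = M \<and> right_action P G act \<and>
     (\<forall>p\<in>P. \<forall>g\<in>carrier G. \<pi> (act p g) = \<pi> p) \<and>
     (\<forall>m\<in>M.
        (\<forall>p \<in> fiber P \<pi> m. \<forall>g \<in> carrier G. act p g = p \<longrightarrow> g = \<one>\<^bsub>G\<^esub>) \<and>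
        (\<forall>p \<in> fiber P \<pi> m. \<forall>q \<in> fiber P \<pi> m. \<exists>g \<in> carrier G. act p g = q) \<and>
        (\<exists>\<psi>. bij_betw \<psi> (fiber P \<pi> m) (carrier G) \<and>
             (\<forall>p \<in> fiber P \<pi> m. \<forall>g \<in> carrier G. \<psi> (act p g) = \<psi> p \<otimes>\<^bsub>G\<^esub> g)))"

text \<open>Surjectivity of the projection, and freeness and transitivity of the action on the fibers,
  follow from the existence of equivariant local trivializations.\<close>

definition topological_principal_bundle ::
    "'p topology \<Rightarrow> 'm topology \<Rightarrow> ('g, 'c) monoid_scheme \<Rightarrow> 'g topology \<Rightarrow>
     ('p \<Rightarrow> 'm) \<Rightarrow> ('p \<Rightarrow> 'g \<Rightarrow> 'p) \<Rightarrow> bool" where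
  "topological_principal_bundle P M G TG \<pi> act \<longleftrightarrow>
     topological_group G TG \<and>
     continuous_map P M \<pi> \<and>
     right_action (topspace P) G act \<and>
     continuous_map (prod_topology P TG) P (\<lambda>(p, g). act p g) \<and>
     (\<forall>p \<in> topspace P. \<forall>g \<in> carrier G. \<pi> (act p g) = \<pi> p) \<and>
     (\<forall>m \<in> topspace M. \<exists>U \<psi>. openin M U \<and> m \<in> U \<and>
        homeomorphic_map (subtopology P {p \<in> topspace P. \<pi> p \<in> U})
          (prod_topology (subtopology M U) TG) (\<lambda>p. (\<pi> p, \<psi> p)) \<and>
        (\<forall>p \<in> topspace P. \<pi> p \<in> U \<longrightarrow> (\<forall>g \<in> carrier G. \<psi> (act p g) = \<psi> p \<otimes>\<^bsub>G\<^esub> g)))"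

definition smooth_principal_bundle ::
    "'p mfd \<Rightarrow> 'm mfd \<Rightarrow> ('g, 'c) monoid_scheme \<Rightarrow> 'g mfd \<Rightarrow>
     ('p \<Rightarrow> 'm) \<Rightarrow> ('p \<Rightarrow> 'g \<Rightarrow> 'p) \<Rightarrow> bool" where
  "smooth_principal_bundle P M G AG \<pi> act \<longleftrightarrow>
     smooth_manifold P \<and> smooth_manifold M \<and> lie_group G AG \<and>
     smooth_map P M \<pi> \<and>
     right_action (topspace (mtop P)) G act \<and>
     smooth_map (prod_mfd P AG) P (\<lambda>(p, g). act p g) \<and>
     (\<forall>p \<in> topspace (mtop P). \<forall>g \<in> carrier G. \<pi> (act p g) = \<pi> p) \<and>
     (\<forall>m \<in> topspace (mtop M). \<exists>U \<psi>. openin (mtop M) U \<and> m \<in> U \<and>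
        diffeomorphism (open_submfd P {p \<in> topspace (mtop P). \<pi> p \<in> U})
          (prod_mfd (open_submfd M U) AG) (\<lambda>p. (\<pi> p, \<psi> p)) \<and>
        (\<forall>p \<in> topspace (mtop P). \<pi> p \<in> U \<longrightarrow>
           (\<forall>g \<in> carrier G. \<psi> (act p g) = \<psi> p \<otimes>\<^bsub>G\<^esub> g)))"


section \<open>Gauge quandles\<close>

definition equivariant ::
    "'p set \<Rightarrow> ('g, 'c) monoid_scheme \<Rightarrow> ('p \<Rightarrow> 'g \<Rightarrow> 'p) \<Rightarrow> ('p \<Rightarrow> 'g) \<Rightarrow> bool" where
  "equivariant P G act f \<longleftrightarrow>
     f \<in> P \<rightarrow> carrier G \<and>
     (\<forall>p\<in>P. \<forall>g\<in>carrier G. f (act p g) = inv\<^bsub>G\<^esub> g \<otimes>\<^bsub>G\<^esub> f p \<otimes>\<^bsub>G\<^esub> g)"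

definition gauge_op ::
    "('g, 'c) monoid_scheme \<Rightarrow> ('p \<Rightarrow> 'g \<Rightarrow> 'p) \<Rightarrow> ('p \<Rightarrow> 'g) \<Rightarrow> 'p \<Rightarrow> 'p \<Rightarrow> 'p" where
  "gauge_op G act f p q = act p (inv\<^bsub>G\<^esub> (f p) \<otimes>\<^bsub>G\<^esub> f q)"

text \<open>The data defining a gauge quandle with operation \<^const>\<open>gauge_op\<close> \<open>G act f\<close>.\<close>

definition discrete_gauge_quandle ::
    "'p set \<Rightarrow> 'm set \<Rightarrow> ('g, 'c) monoid_scheme \<Rightarrow>
     ('p \<Rightarrow> 'm) \<Rightarrow> ('p \<Rightarrow> 'g \<Rightarrow> 'p) \<Rightarrow> ('p \<Rightarrow> 'g) \<Rightarrow> bool" where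
  "discrete_gauge_quandle P M G \<pi> act f \<longleftrightarrow>
     discrete_principal_bundle P M G \<pi> act \<and> equivariant P G act f"

definition topological_gauge_quandle ::
    "'p topology \<Rightarrow> 'm topology \<Rightarrow> ('g, 'c) monoid_scheme \<Rightarrow> 'g topology \<Rightarrow>
     ('p \<Rightarrow> 'm) \<Rightarrow> ('p \<Rightarrow> 'g \<Rightarrow> 'p) \<Rightarrow> ('p \<Rightarrow> 'g) \<Rightarrow> bool" where
  "topological_gauge_quandle P M G TG \<pi> act f \<longleftrightarrow>
     topological_principal_bundle P M G TG \<pi> act \<and>
     equivariant (topspace P) G act f \<and> continuous_map P TG f"

definition smooth_gauge_quandle ::
    "'p mfd \<Rightarrow> 'm mfd \<Rightarrow> ('g, 'c) monoid_scheme \<Rightarrow> 'g mfd \<Rightarrow>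
     ('p \<Rightarrow> 'm) \<Rightarrow> ('p \<Rightarrow> 'g \<Rightarrow> 'p) \<Rightarrow> ('p \<Rightarrow> 'g) \<Rightarrow> bool" where
  "smooth_gauge_quandle P M G AG \<pi> act f \<longleftrightarrow>
     smooth_principal_bundle P M G AG \<pi> act \<and>
     equivariant (topspace (mtop P)) G act f \<and> smooth_map P AG f"

text \<open>The fibers of a smooth principal bundle are embedded submanifolds of the total space, of the
  dimension of the structure group.\<close>

definition fiber_mfd ::
    "'p mfd \<Rightarrow> 'g mfd \<Rightarrow> ('p \<Rightarrow> 'm) \<Rightarrow> 'm \<Rightarrow> 'p mfd" where
  "fiber_mfd P AG \<pi> m = embedded_submfd P (fiber (topspace (mtop P)) \<pi> m) (mdim AG)"

end

theory Submission
  imports Defs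
begin

text \<open>
  Let \<open>\<psi>\<close> be the fibre coordinate of a trivialization around \<open>m\<close> and \<open>p\<^sub>0\<close> the point of the fibre with
  \<open>\<psi> p\<^sub>0 = 1\<close>. Then \<open>p = p\<^sub>0 \<cdot> \<psi> p\<close> on the fibre, so \<open>f p = (\<psi> p)\<^sup>-\<^sup>1 (f p\<^sub>0) (\<psi> p)\<close> by equivariance, and a
  computation in \<open>G\<close> shows that \<open>\<psi>\<close> turns the gauge operation into the generalized Alexander operation
  for conjugation by \<open>(f p\<^sub>0)\<^sup>-\<^sup>1\<close>. The inverse of \<open>\<psi>\<close> on the fibre is \<open>g \<mapsto> \<Phi>\<^sup>-\<^sup>1 (m, g)\<close> for the trivialization
  \<open>\<Phi>\<close>, so \<open>\<psi>\<close> is a homeomorphism or diffeomorphism; in the smooth case it also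
  provides the charts that make the fibre an embedded submanifold.
\<close>

section \<open>Calculus on open subsets of Euclidean space\<close>

text \<open>The algebra is short; most of the work is caused by the smooth case. Smoothness is
  defined through iterated partial derivatives along coordinate lines, so already the composition of
  two smooth maps rests on a chain rule, and the chain rule on the mean value theorem together with
  continuity of the partials. A second burden is that the isomorphism predicates also assert that
  both sides are quandles of the given kind. On \<open>G\<close> this comes from writing the
  operation as a word in the group operations. On the fibre the quandle axioms, and continuity or
  smoothness of the operation, are pulled back along \<psi> instead of being verified from the gauge
  formula. A third is that the fibre carries a structure inherited from the total space which
  mentions no trivialization. Its charts are therefore arbitrary, and their compatibility has to
  follow from the definition of an embedded submanifold alone.\<close>

lemma Euclidean_space_eq_top_of_set:
  "Euclidean_space n = top_of_set {x. \<forall>i\<ge>n. x i = 0}"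
  by (simp add: Euclidean_space_def euclidean_product_topology)

lemma openin_Euclidean_space_zero:
  "openin (Euclidean_space n) U \<Longrightarrow> x \<in> U \<Longrightarrow> i \<ge> n \<Longrightarrow> x i = 0"
  using openin_subset[of "Euclidean_space n" U] by (auto simp: topspace_Euclidean_space)

text \<open>Since \<open>U\<close> lies inside Euclidean space, both descriptions use the subspace
  topology of the same function space; this turns the continuity clauses of \<open>C_diff\<close>
  into statements about \<open>continuous_on\<close>.\<close>

lemma continuous_map_Euclidean_subtopology:
  assumes "openin (Euclidean_space n) U"
  shows "continuous_map (subtopology (Euclidean_space n) U) euclideanreal h \<longleftrightarrow> continuous_on U h"
proof -
  have "U \<subseteq> {x. \<forall>i\<ge>n. x i = 0}"
    using openin_subset[OF assms] by (simp add: topspace_Euclidean_space)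
  then show ?thesis
    by (simp add: Euclidean_space_eq_top_of_set subtopology_subtopology Int_absorb1)
qed

lemma continuous_map_into_Euclidean_space:
  "continuous_map X (Euclidean_space n) g \<longleftrightarrow>
     (\<forall>i<n. continuous_map X euclideanreal (\<lambda>x. g x i)) \<and> (\<forall>x\<in>topspace X. \<forall>i\<ge>n. g x i = 0)"
proof -
  \<comment> \<open>The coordinates from \<open>n\<close> on are constantly 0, so asking for
    continuity of the first \<open>n\<close> only loses nothing against the product
    topology.\<close>
  have "continuous_map X euclideanreal (\<lambda>x. g x i)"
    if "\<forall>x\<in>topspace X. \<forall>i\<ge>n. g x i = 0" "i \<ge> n" for i
    by (rule continuous_map_eq[of X euclideanreal "\<lambda>x. 0"]) (use that in auto)
  then have "(\<forall>i<n. continuous_map X euclideanreal (\<lambda>x. g x i)) \<longleftrightarrow>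
      (\<forall>i. continuous_map X euclideanreal (\<lambda>x. g x i))"
    if "\<forall>x\<in>topspace X. \<forall>i\<ge>n. g x i = 0"
    using that not_le by blast
  moreover have "g ` topspace X \<subseteq> {x. \<forall>i\<ge>n. x i = 0} \<longleftrightarrow> (\<forall>x\<in>topspace X. \<forall>i\<ge>n. g x i = 0)"
    by auto
  ultimately show ?thesis
    unfolding Euclidean_space_def continuous_map_in_subtopology continuous_map_componentwise_UNIV
    by (simp add: image_subset_iff_funcset) blast
qed

text \<open>Makes one-variable derivatives at points of \<open>U\<close> depend on the values on
  \<open>U\<close> alone. The bound on \<open>i\<close> keeps the moved point in Euclidean space,
  where all coordinates from \<open>n\<close> on are 0.\<close>

lemma eventually_fun_upd_in_open:
  assumes "openin (Euclidean_space n) U" "x \<in> U" "i < n"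
  shows "\<forall>\<^sub>F t in nhds (x i). x(i := t) \<in> U"
proof -
  have "continuous_map euclideanreal (Euclidean_space n) (\<lambda>t. x(i := t))"
    using openin_Euclidean_space_zero[OF assms(1,2)] assms(3)
    by (auto simp: continuous_map_into_Euclidean_space)
  then have "open {t. x(i := t) \<in> U}"
    using assms(1) by (fastforce simp: continuous_map_def)
  moreover have "x(i := x i) \<in> U"
    using assms by simp
  ultimately show ?thesis
    by (metis (mono_tags, lifting) eventually_nhds mem_Collect_eq)
qed

text \<open>A basic open set of the product topology is a box. Its first \<open>m\<close> sides
  yield a common radius, and the other sides are met because \<open>y\<close> and \<open>z\<close>
  both vanish in those coordinates.\<close>

lemma openin_Euclidean_space_box:
  assumes "openin (Euclidean_space m) V" "y \<in> V"
  obtains e where "e > 0"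
    "\<And>z. \<lbrakk>\<And>i. i < m \<Longrightarrow> \<bar>z i - y i\<bar> < e; \<And>i. i \<ge> m \<Longrightarrow> z i = 0\<rbrakk> \<Longrightarrow> z \<in> V"
proof -
  obtain T where T: "openin (powertop_real UNIV) T" "V = T \<inter> {x. \<forall>i\<ge>m. x i = 0}"
    using assms(1) by (auto simp: Euclidean_space_def openin_subtopology)
  then have "y \<in> T" using assms(2) by simp
  from product_topology_open_contains_basis[OF T(1) this] obtain X where X: "y \<in> Pi\<^sub>E UNIV X" "\<And>i. open (X i)" "Pi\<^sub>E UNIV X \<subseteq> T"
    by auto
  have "\<exists>e>0. \<forall>s. \<bar>s - y i\<bar> < e \<longrightarrow> s \<in> X i" for i
    using X(1) X(2)[of i] unfolding open_dist dist_real_def by (auto simp: PiE_def)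
  then obtain d where d: "\<And>i. d i > 0" "\<And>i s. \<bar>s - y i\<bar> < d i \<Longrightarrow> s \<in> X i"
    by metis
  \<comment> \<open>The inserted 1 keeps the set nonempty when \<open>m\<close> is 0.\<close>
  define e where "e = Min (insert 1 (d ` {..<m}))"
  have e: "e > 0" "\<And>i. i < m \<Longrightarrow> e \<le> d i"
    unfolding e_def using d(1) by (auto intro!: Min_le)
  show ?thesis
  proof (rule that[OF e(1)])
    fix z assume z: "\<And>i. i < m \<Longrightarrow> \<bar>z i - y i\<bar> < e" "\<And>i. i \<ge> m \<Longrightarrow> z i = 0"
    have "z i \<in> X i" for i
    proof (cases "i < m")
      case True
      then show ?thesis using z(1)[of i] e(2)[of i] d(2)[of "z i" i] by linarith
    next
      case False
      then have "z i = y i"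
        using z(2) openin_Euclidean_space_zero[OF assms] by simp
      then show ?thesis using d(1)[of i] d(2)[of "z i" i] by simp
    qed
    then show "z \<in> V" using T(2) X(3) z(2) by (auto simp: PiE_def)
  qed
qed

section \<open>Rules for \<open>C_diff\<close>: congruence, locality, sums and products\<close>

lemma has_partial_deriv:
  assumes "C_diff n (Suc k) U h" "i < n" "x \<in> U"
  shows "((\<lambda>t. h (x(i := t))) has_field_derivative partial_deriv i h x) (at (x i))"
  using assms by (auto simp: partial_deriv_def DERIV_deriv_iff_field_differentiable)

lemma C_diff_imp_continuous_on:
  assumes "openin (Euclidean_space n) U" "C_diff n k U h"
  shows "continuous_on U h"
  using assms by (cases k) (auto simp: continuous_map_Euclidean_subtopology)

text \<open>A partial derivative at a point of \<open>U\<close> sees only a short coordinate segment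
  inside \<open>U\<close>, so agreement on \<open>U\<close> passes to the partials and the induction
  goes through. Needed because expressions built with \<open>inv_into\<close> agree only on chart
  images.\<close>

lemma C_diff_cong:
  assumes "openin (Euclidean_space n) U" "\<And>x. x \<in> U \<Longrightarrow> h x = h' x" "C_diff n k U h"
  shows "C_diff n k U h'"
  using assms(2,3)
proof (induction k arbitrary: h h')
  case 0
  then show ?case
    using assms(1) by (auto simp: continuous_map_Euclidean_subtopology cong: continuous_on_cong)
next
  case (Suc k)
  have ev: "\<forall>\<^sub>F t in nhds (x i). h (x(i := t)) = h' (x(i := t))" if "x \<in> U" "i < n" for x i
    using eventually_fun_upd_in_open[OF assms(1) that]
    by (rule eventually_mono) (rule Suc.prems(1))
  have "continuous_on U h'"
    using C_diff_imp_continuous_on[OF assms(1) Suc.prems(2)]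
      continuous_on_cong[OF refl Suc.prems(1), of U] by simp
  moreover have "(\<lambda>t. h' (x(i := t))) field_differentiable at (x i)" if "x \<in> U" "i < n" for x i
    using DERIV_cong_ev[OF refl ev[OF that] refl] has_partial_deriv[OF Suc.prems(2) that(2,1)]
    unfolding field_differentiable_def by blast
  moreover have "C_diff n k U (partial_deriv i h')" if "i < n" for i
  proof (rule Suc.IH)
    show "partial_deriv i h x = partial_deriv i h' x" if "x \<in> U" for x
      unfolding partial_deriv_def using deriv_cong_ev[OF ev[OF that \<open>i < n\<close>] refl] .
    show "C_diff n k U (partial_deriv i h)" using Suc.prems(2) that by simp
  qed
  ultimately show ?case
    using assms(1) by (simp add: continuous_map_Euclidean_subtopology)
qed

text \<open>Allows the partials to be given by a formula \<open>D\<close>, so that the rules below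
  can use the usual differentiation formulas instead of terms in \<open>deriv\<close>.\<close>

lemma C_diff_SucI:
  assumes "openin (Euclidean_space n) U" "continuous_on U h"
    and "\<And>i x. i < n \<Longrightarrow> x \<in> U \<Longrightarrow> ((\<lambda>t. h (x(i := t))) has_field_derivative D i x) (at (x i))"
    and "\<And>i. i < n \<Longrightarrow> C_diff n k U (D i)"
  shows "C_diff n (Suc k) U h"
proof -
  have "C_diff n k U (partial_deriv i h)" if "i < n" for i
    using DERIV_imp_deriv[OF assms(3)[OF that]]
    by (intro C_diff_cong[OF assms(1) _ assms(4)[OF that]]) (simp add: partial_deriv_def)
  then show ?thesis
    using assms by (auto simp: continuous_map_Euclidean_subtopology field_differentiable_def)
qed

lemma C_diff_subset:
  assumes "openin (Euclidean_space n) U" "openin (Euclidean_space n) N" "N \<subseteq> U" "C_diff n k U h"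
  shows "C_diff n k N h"
  using assms(4)
proof (induction k arbitrary: h)
  case 0
  then show ?case
    using assms by (auto simp: continuous_map_Euclidean_subtopology intro: continuous_on_subset)
next
  case (Suc k)
  then show ?case
    using assms by (auto simp: continuous_map_Euclidean_subtopology intro: continuous_on_subset)
qed

text \<open>\<open>U\<close> need not be open in the whole function space, so the neighbourhood
  filter is localized with an open set \<open>O1\<close> that cuts \<open>N\<close> out of Euclidean
  space.\<close>

lemma continuous_on_openin_local:
  assumes U: "openin (Euclidean_space n) U"
    and loc: "\<And>x. x \<in> U \<Longrightarrow> \<exists>N. openin (Euclidean_space n) N \<and> x \<in> N \<and> continuous_on N h"
  shows "continuous_on U h"
  unfolding continuous_on_eq_continuous_within
proof
  fix x assume x: "x \<in> U"
  obtain N where N: "openin (Euclidean_space n) N" "x \<in> N" "continuous_on N h"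
    using loc x by blast
  obtain O1 where O1: "open O1" "N = {x. \<forall>i\<ge>n. x i = 0} \<inter> O1"
    using N(1) by (auto simp: Euclidean_space_eq_top_of_set openin_open)
  have "continuous (at x within N \<inter> U) h"
    using N(2,3) by (auto simp: continuous_on_eq_continuous_within intro: continuous_within_subset)
  moreover have "at x within N \<inter> U = at x within U"
    using O1 N(2) openin_Euclidean_space_zero[OF U]
    by (intro at_within_nhd[of x O1]) auto
  ultimately show "continuous (at x within U) h" by simp
qed

lemma C_diff_local:
  assumes U: "openin (Euclidean_space n) U"
    and loc: "\<And>x. x \<in> U \<Longrightarrow> \<exists>N. openin (Euclidean_space n) N \<and> x \<in> N \<and> C_diff n k N h"
  shows "C_diff n k U h"
proof -
  have cont: "continuous_on U h" if "\<And>x. x \<in> U \<Longrightarrow> \<exists>N. openin (Euclidean_space n) N \<and> x \<in> N \<and> C_diff n k N h" for k h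
    using continuous_on_openin_local[OF U] that C_diff_imp_continuous_on by metis
  show ?thesis
    using loc
  proof (induction k arbitrary: h)
    case 0
    then show ?case
      using cont[of 0 h] U by (simp add: continuous_map_Euclidean_subtopology)
  next
    case (Suc k)
    have "((\<lambda>t. h (x(i := t))) has_field_derivative partial_deriv i h x) (at (x i))"
      if "i < n" "x \<in> U" for i x
      using Suc.prems[OF that(2)] has_partial_deriv that(1) by blast
    moreover have "C_diff n k U (partial_deriv i h)" if "i < n" for i
      using Suc.IH[of "partial_deriv i h"] Suc.prems that by (meson C_diff.simps(2))
    ultimately show ?case
      by (intro C_diff_SucI[OF U cont[OF Suc.prems]])
  qed
qed

text \<open>Not immediate from the recursion: order \<open>Suc k\<close> asks for partials of order
  \<open>k\<close>, not for the function itself to have order \<open>k\<close>. The product and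
  chain rules need the latter for the factors that stay undifferentiated.\<close>

lemma C_diff_Suc_imp:
  assumes "openin (Euclidean_space n) U" "C_diff n (Suc k) U h"
  shows "C_diff n k U h"
  using assms(2)
proof (induction k arbitrary: h)
  case (Suc k)
  show ?case
  proof (rule C_diff_SucI[OF assms(1)])
    show "continuous_on U h"
      using C_diff_imp_continuous_on[OF assms(1) Suc.prems] .
    show "((\<lambda>t. h (x(i := t))) has_field_derivative partial_deriv i h x) (at (x i))"
      if "i < n" "x \<in> U" for i x
      using has_partial_deriv[OF Suc.prems] that .
    show "C_diff n k U (partial_deriv i h)" if "i < n" for i
      using Suc.IH Suc.prems that by simp
  qed
qed simp

lemma C_diff_const:
  assumes "openin (Euclidean_space n) U"
  shows "C_diff n k U (\<lambda>x. c)"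
proof (induction k arbitrary: c)
  case 0
  then show ?case by simp
next
  case (Suc k)
  show ?case
    by (rule C_diff_SucI[OF assms, where D = "\<lambda>i x. 0"]) (auto intro: Suc)
qed

lemma C_diff_coord:
  assumes "openin (Euclidean_space n) U"
  shows "C_diff n k U (\<lambda>x. x j)"
proof (cases k)
  case 0
  have "continuous_on U (\<lambda>x. x j)"
    by (rule continuous_on_product_then_coordinatewise) (rule continuous_on_id)
  then show ?thesis
    using 0 assms by (simp add: continuous_map_Euclidean_subtopology)
next
  case (Suc k')
  have "C_diff n (Suc k') U (\<lambda>x. x j)"
  proof (rule C_diff_SucI[OF assms, where D = "\<lambda>i x. if i = j then 1 else 0"])
    show "continuous_on U (\<lambda>x. x j)"
      by (rule continuous_on_product_then_coordinatewise) (rule continuous_on_id)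
  qed (auto intro: C_diff_const[OF assms])
  then show ?thesis using Suc by simp
qed

lemma C_diff_add:
  assumes U: "openin (Euclidean_space n) U" and "C_diff n k U h" "C_diff n k U g"
  shows "C_diff n k U (\<lambda>x. h x + g x)"
  using assms(2,3)
proof (induction k arbitrary: h g)
  case 0
  then show ?case
    using U by (auto simp: continuous_map_Euclidean_subtopology intro: continuous_intros)
next
  case (Suc k)
  show ?case
  proof (rule C_diff_SucI[OF U, where D = "\<lambda>i x. partial_deriv i h x + partial_deriv i g x"])
    show "continuous_on U (\<lambda>x. h x + g x)"
      using Suc.prems U by (intro continuous_intros C_diff_imp_continuous_on)
    show "((\<lambda>t. h (x(i := t)) + g (x(i := t))) has_field_derivative
        partial_deriv i h x + partial_deriv i g x) (at (x i))" if "i < n" "x \<in> U" for i x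
      using Suc.prems that by (intro DERIV_add has_partial_deriv)
    show "C_diff n k U (\<lambda>x. partial_deriv i h x + partial_deriv i g x)" if "i < n" for i
      using Suc that by simp
  qed
qed

lemma C_diff_mult:
  assumes U: "openin (Euclidean_space n) U" and "C_diff n k U h" "C_diff n k U g"
  shows "C_diff n k U (\<lambda>x. h x * g x)"
  using assms(2,3)
proof (induction k arbitrary: h g)
  case 0
  then show ?case
    using U by (auto simp: continuous_map_Euclidean_subtopology intro: continuous_intros)
next
  case (Suc k)
  show ?case
  proof (rule C_diff_SucI[OF U, where D = "\<lambda>i x. partial_deriv i h x * g x + partial_deriv i g x * h x"])
    show "continuous_on U (\<lambda>x. h x * g x)"
      using Suc.prems U by (intro continuous_intros C_diff_imp_continuous_on)
    show "((\<lambda>t. h (x(i := t)) * g (x(i := t))) has_field_derivative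
        partial_deriv i h x * g x + partial_deriv i g x * h x) (at (x i))" if "i < n" "x \<in> U" for i x
      using DERIV_mult[OF has_partial_deriv[OF Suc.prems(1) that] has_partial_deriv[OF Suc.prems(2) that]]
      by (simp only: fun_upd_triv)
    have "C_diff n k U h" "C_diff n k U g"
      using C_diff_Suc_imp[OF U] Suc.prems by blast+
    then show "C_diff n k U (\<lambda>x. partial_deriv i h x * g x + partial_deriv i g x * h x)" if "i < n" for i
      using Suc that by (intro C_diff_add[OF U] Suc.IH) auto
  qed
qed

lemma C_diff_sum:
  assumes U: "openin (Euclidean_space n) U" and "finite J" "\<And>j. j \<in> J \<Longrightarrow> C_diff n k U (h j)"
  shows "C_diff n k U (\<lambda>x. \<Sum>j\<in>J. h j x)"
  using assms(2,3)
  by (induction J rule: finite_induct) (auto intro: C_diff_const[OF U] C_diff_add[OF U])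

section \<open>Mean value theorem and chain rule\<close>

lemma mvt_closed_segment:
  fixes \<phi> :: "real \<Rightarrow> real"
  assumes "\<And>s. s \<in> closed_segment a b \<Longrightarrow> (\<phi> has_real_derivative \<phi>' s) (at s)"
  obtains \<xi> where "\<xi> \<in> closed_segment a b" "\<phi> b - \<phi> a = \<phi>' \<xi> * (b - a)"
proof (cases a b rule: linorder_cases)
  case less
  then obtain z where "a < z" "z < b" "\<phi> b - \<phi> a = (b - a) * \<phi>' z"
    using MVT2[of a b \<phi> \<phi>'] assms by (auto simp: closed_segment_eq_real_ivl)
  then show ?thesis using that[of z] less by (auto simp: closed_segment_eq_real_ivl)
next
  case equal
  then show ?thesis using that[of a] by simp
next
  case greater
  then obtain z where "b < z" "z < a" "\<phi> a - \<phi> b = (a - b) * \<phi>' z"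
    using MVT2[of b a \<phi> \<phi>'] assms by (auto simp: closed_segment_eq_real_ivl)
  then show ?thesis
    using that[of z] greater by (auto simp: closed_segment_eq_real_ivl algebra_simps)
qed

text \<open>The increment of \<open>h\<close> along the curve is telescoped over the coordinates; each summand is
  treated by the mean value theorem in a single variable.\<close>

lemma has_real_derivative_along_curve:
  assumes V: "openin (Euclidean_space m) V" and y: "\<gamma> t0 \<in> V"
    and ev: "\<forall>\<^sub>F t in at t0. \<gamma> t \<in> V"
    and \<gamma>': "\<And>j. j < m \<Longrightarrow> ((\<lambda>t. \<gamma> t j) has_real_derivative \<gamma>' j) (at t0)"
    and h: "C_diff m (Suc 0) V h"
  shows "((\<lambda>t. h (\<gamma> t)) has_real_derivative (\<Sum>j<m. partial_deriv j h (\<gamma> t0) * \<gamma>' j)) (at t0)"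
proof -
  define y where "y = \<gamma> t0"
  \<comment> \<open>Hybrid points: the first \<open>j\<close> coordinates come from the curve, the
    others from the base point. Thus \<open>z 0 t\<close> is the start of the telescope,
    \<open>z m t\<close> its end, and one step changes one coordinate.\<close>
  define z where "z j t = (\<lambda>i. if i < j then \<gamma> t i else y i)" for j t
  have y0: "y i = 0" if "i \<ge> m" for i
    using openin_Euclidean_space_zero[OF V assms(2)] that by (simp add: y_def)
  have near: "\<forall>\<^sub>F t in at t0. \<forall>i<m. \<bar>\<gamma> t i - y i\<bar> < e" if "e > 0" for e
  proof -
    have "\<forall>\<^sub>F t in at t0. \<bar>\<gamma> t i - y i\<bar> < e" if i: "i < m" for i
      using DERIV_isCont[OF \<gamma>'[OF i]] \<open>e > 0\<close> 
      by (auto simp: isCont_def y_def tendsto_iff dist_real_def)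
    then have "\<forall>\<^sub>F t in at t0. \<forall>i\<in>{..<m}. \<bar>\<gamma> t i - y i\<bar> < e"
      by (intro eventually_ball_finite) auto
    then show ?thesis by (simp add: Ball_def)
  qed
  \<comment> \<open>When the curve is within \<open>e\<close> of \<open>y\<close> in each of the
    first \<open>m\<close> coordinates, so is every hybrid point whose coordinate \<open>j\<close>
    is moved between \<open>y j\<close> and \<open>\<gamma> t j\<close>; hence it stays in
    \<open>V\<close>, where the partials are available.\<close>
  obtain e where e: "e > 0"
    "\<And>z. \<lbrakk>\<And>i. i < m \<Longrightarrow> \<bar>z i - y i\<bar> < e; \<And>i. i \<ge> m \<Longrightarrow> z i = 0\<rbrakk> \<Longrightarrow> z \<in> V"
    unfolding y_def by (rule openin_Euclidean_space_box[OF V assms(2)]) blast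
  have lim: "((\<lambda>t. (h (z (Suc j) t) - h (z j t)) / (t - t0)) \<longlongrightarrow> partial_deriv j h y * \<gamma>' j) (at t0)"
    if j: "j < m" for j
  proof -
    \<comment> \<open>Unordered segments are used because \<open>\<gamma> t j\<close> may lie on
      either side of \<open>y j\<close> or coincide with it; in the last case both sides of the
      equation are 0.\<close>
    have "\<exists>\<xi>. \<xi> \<in> closed_segment (y j) (\<gamma> t j) \<and>
       h (z (Suc j) t) - h (z j t) = partial_deriv j h ((z j t)(j := \<xi>)) * (\<gamma> t j - y j)"
      if t: "\<forall>i<m. \<bar>\<gamma> t i - y i\<bar> < e" for t
    proof -
      have "((\<lambda>s. h ((z j t)(j := s))) has_real_derivative partial_deriv j h ((z j t)(j := s))) (at s)"
        if s: "s \<in> closed_segment (y j) (\<gamma> t j)" for s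
      proof -
        have "(z j t)(j := s) \<in> V"
        proof (rule e(2))
          fix i assume "i < m"
          have "\<bar>s - y j\<bar> \<le> \<bar>\<gamma> t j - y j\<bar>"
            using s by (auto simp: closed_segment_eq_real_ivl split: if_splits)
          then show "\<bar>((z j t)(j := s)) i - y i\<bar> < e"
            using t[rule_format, of i] t[rule_format, of j] j \<open>i < m\<close> e(1) by (auto simp: z_def)
        qed (use j y0 in \<open>auto simp: z_def\<close>)
        from has_partial_deriv[OF h j this] show ?thesis by simp
      qed
      then obtain \<xi> where "\<xi> \<in> closed_segment (y j) (\<gamma> t j)"
        "h ((z j t)(j := \<gamma> t j)) - h ((z j t)(j := y j)) =
           partial_deriv j h ((z j t)(j := \<xi>)) * (\<gamma> t j - y j)"
        by (rule mvt_closed_segment)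
      moreover have "(z j t)(j := \<gamma> t j) = z (Suc j) t" "(z j t)(j := y j) = z j t"
        by (auto simp: z_def fun_eq_iff less_Suc_eq)
      ultimately show ?thesis by auto
    qed
    then obtain \<xi> where \<xi>: "\<And>t. \<forall>i<m. \<bar>\<gamma> t i - y i\<bar> < e \<Longrightarrow> \<xi> t \<in> closed_segment (y j) (\<gamma> t j) \<and>
       h (z (Suc j) t) - h (z j t) = partial_deriv j h ((z j t)(j := \<xi> t)) * (\<gamma> t j - y j)"
      by metis
    have "((\<lambda>t. partial_deriv j h ((z j t)(j := \<xi> t))) \<longlongrightarrow> partial_deriv j h y) (at t0)"
    proof (rule tendstoI)
      fix e' :: real assume e': "e' > 0"
      \<comment> \<open>On \<open>W\<close> the partial differs from its value at \<open>y\<close>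
        by less than \<open>e'\<close>. Continuity of the partial makes \<open>W\<close> open, so a
        box around \<open>y\<close> fits into it and catches the intermediate points as
        well.\<close>
      define W where "W = {x \<in> V. dist (partial_deriv j h x) (partial_deriv j h y) < e'}"
      have "continuous_on V (partial_deriv j h)"
        using h j V by (auto simp: continuous_map_Euclidean_subtopology)
      then have "openin (top_of_set V) (V \<inter> partial_deriv j h -` ball (partial_deriv j h y) e')"
        by (rule continuous_openin_preimage_gen) simp
      moreover have "V \<inter> partial_deriv j h -` ball (partial_deriv j h y) e' = W"
        by (auto simp: W_def dist_commute)
      ultimately have "openin (top_of_set V) W" by simp
      then have W: "openin (Euclidean_space m) W"
        using V openin_trans unfolding Euclidean_space_eq_top_of_set by blast
      have "y \<in> W" using assms(2) e' by (simp add: W_def y_def)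
      then obtain d where d: "d > 0"
        "\<And>z. \<lbrakk>\<And>i. i < m \<Longrightarrow> \<bar>z i - y i\<bar> < d; \<And>i. i \<ge> m \<Longrightarrow> z i = 0\<rbrakk> \<Longrightarrow> z \<in> W"
        by (rule openin_Euclidean_space_box[OF W]) blast
      have "(z j t)(j := \<xi> t) \<in> W"
        if t: "\<forall>i<m. \<bar>\<gamma> t i - y i\<bar> < e" "\<forall>i<m. \<bar>\<gamma> t i - y i\<bar> < d" for t
      proof (rule d(2))
        fix i assume "i < m"
        have "\<bar>\<xi> t - y j\<bar> \<le> \<bar>\<gamma> t j - y j\<bar>"
          using \<xi>[OF t(1)] by (auto simp: closed_segment_eq_real_ivl split: if_splits)
        then show "\<bar>((z j t)(j := \<xi> t)) i - y i\<bar> < d"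
          using t(2)[rule_format, of i] t(2)[rule_format, of j] j \<open>i < m\<close> d(1) by (auto simp: z_def)
      qed (use j y0 in \<open>auto simp: z_def\<close>)
      then show "\<forall>\<^sub>F t in at t0. dist (partial_deriv j h ((z j t)(j := \<xi> t))) (partial_deriv j h y) < e'"
        by (intro eventually_mono[OF eventually_conj[OF near[OF e(1)] near[OF d(1)]]])
           (auto simp: W_def)
    qed
    moreover have "((\<lambda>t. (\<gamma> t j - y j) / (t - t0)) \<longlongrightarrow> \<gamma>' j) (at t0)"
      using \<gamma>'[OF j] by (simp add: has_field_derivative_iff y_def)
    ultimately have "((\<lambda>t. partial_deriv j h ((z j t)(j := \<xi> t)) * ((\<gamma> t j - y j) / (t - t0)))
      \<longlongrightarrow> partial_deriv j h y * \<gamma>' j) (at t0)"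
      by (rule tendsto_mult)
    then show ?thesis
      by (rule Lim_transform_eventually) (use near[OF e(1)] \<xi> in \<open>auto elim!: eventually_mono\<close>)
  qed
  have "((\<lambda>t. \<Sum>j<m. (h (z (Suc j) t) - h (z j t)) / (t - t0)) \<longlongrightarrow>
      (\<Sum>j<m. partial_deriv j h y * \<gamma>' j)) (at t0)"
    by (rule tendsto_sum) (use lim in auto)
  moreover have "(\<Sum>j<m. (h (z (Suc j) t) - h (z j t)) / (t - t0)) = (h (\<gamma> t) - h (\<gamma> t0)) / (t - t0)"
    if "\<gamma> t \<in> V" for t
  proof -
    have "(\<Sum>j<m. (h (z (Suc j) t) - h (z j t)) / (t - t0)) = (h (z m t) - h (z 0 t)) / (t - t0)"
      by (simp add: sum_lessThan_telescope[of "\<lambda>j. h (z j t)"] flip: sum_divide_distrib)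
    \<comment> \<open>In the coordinates from \<open>m\<close> on the hybrid still has the entries
      of \<open>y\<close>; they match those of \<open>\<gamma> t\<close> because both points lie in
      \<open>V\<close> and vanish there.\<close>
    moreover have "z m t = \<gamma> t" "z 0 t = \<gamma> t0"
      using openin_Euclidean_space_zero[OF V that] y0 by (auto simp: z_def y_def fun_eq_iff)
    ultimately show ?thesis by simp
  qed
  ultimately have "((\<lambda>t. (h (\<gamma> t) - h (\<gamma> t0)) / (t - t0)) \<longlongrightarrow>
      (\<Sum>j<m. partial_deriv j h y * \<gamma>' j)) (at t0)"
    by (rule Lim_transform_eventually[rotated -1, OF eventually_mono[OF ev], rotated]) auto
  then show ?thesis by (simp add: has_field_derivative_iff y_def)
qed

text \<open>Induction on the order: a partial of the composite is a sum of products of a partial of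
  \<open>h\<close> after \<open>F\<close>, to which the induction hypothesis applies, and a partial
  of a coordinate of \<open>F\<close>.\<close>

lemma C_diff_compose:
  assumes U: "openin (Euclidean_space n) U" and V: "openin (Euclidean_space m) V"
    and F: "F ` U \<subseteq> V" "\<And>j. j < m \<Longrightarrow> C_diff n k U (\<lambda>x. F x j)"
    and h: "C_diff m k V h"
  shows "C_diff n k U (\<lambda>x. h (F x))"
  using F(2) h
proof (induction k arbitrary: h)
  case 0
  have "continuous_on U (\<lambda>x. F x j)" for j
  proof (cases "j < m")
    case True
    then show ?thesis using 0 C_diff_imp_continuous_on[OF U] by blast
  next
    case False
    then have "F x j = 0" if "x \<in> U" for x
      using openin_Euclidean_space_zero[OF V] F(1) that by fastforce
    then show ?thesis by (simp cong: continuous_on_cong)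
  qed
  then have "continuous_on U F" by (rule continuous_on_coordinatewise_then_product)
  then have "continuous_on U (\<lambda>x. h (F x))"
    using continuous_on_compose2[OF C_diff_imp_continuous_on[OF V 0(2)] _ F(1)] by blast
  then show ?case using U by (simp add: continuous_map_Euclidean_subtopology)
next
  case (Suc k)
  \<comment> \<open>The induction hypothesis with \<open>F\<close> lowered to order
    \<open>k\<close>, left open in the outer function: it is used for \<open>h\<close> and for each
    of its partials.\<close>
  note C0 = Suc.IH[OF C_diff_Suc_imp[OF U Suc.prems(1)]]
  show ?case
  proof (rule C_diff_SucI[OF U, where D = "\<lambda>i x. \<Sum>j<m. partial_deriv j h (F x) * partial_deriv i (\<lambda>x. F x j) x"])
    show "continuous_on U (\<lambda>x. h (F x))"
      using C_diff_imp_continuous_on[OF U C0[OF _ C_diff_Suc_imp[OF V Suc.prems(2)]]] .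
    have h1: "C_diff m (Suc 0) V h"
      using Suc.prems(2) C_diff_imp_continuous_on[OF V] V
      by (auto simp: continuous_map_Euclidean_subtopology)
    show "((\<lambda>t. h (F (x(i := t)))) has_field_derivative
        (\<Sum>j<m. partial_deriv j h (F x) * partial_deriv i (\<lambda>x. F x j) x)) (at (x i))"
      if "i < n" "x \<in> U" for i x
    proof -
      have "\<forall>\<^sub>F t in at (x i). F (x(i := t)) \<in> V"
        using eventually_fun_upd_in_open[OF U that(2,1)] F(1)
        by (auto simp: eventually_at_filter elim!: eventually_mono)
      moreover have "F (x(i := x i)) \<in> V"
        using that F(1) by auto
      moreover have "((\<lambda>t. F (x(i := t)) j) has_field_derivative
          partial_deriv i (\<lambda>x. F x j) x) (at (x i))" if "j < m" for j
        using has_partial_deriv[OF Suc.prems(1)[OF that] \<open>i < n\<close> \<open>x \<in> U\<close>] .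
      ultimately show ?thesis
        using has_real_derivative_along_curve[OF V _ _ _ h1, of "\<lambda>t. F (x(i := t))" "x i"] by simp
    qed
    show "C_diff n k U (\<lambda>x. \<Sum>j<m. partial_deriv j h (F x) * partial_deriv i (\<lambda>x. F x j) x)"
      if "i < n" for i
      using Suc.prems that by (intro C_diff_sum[OF U] C_diff_mult[OF U] C0) auto
  qed
qed

section \<open>Smooth maps between manifolds\<close>

lemma continuous_map_Euclidean_space_coord:
  "continuous_map (Euclidean_space n) euclideanreal (\<lambda>x. x i)"
  unfolding Euclidean_space_def
  by (intro continuous_map_from_subtopology continuous_map_product_projection) simp

lemma smooth_euclidean_cong:
  assumes "openin (Euclidean_space n) U" "\<And>x. x \<in> U \<Longrightarrow> F x = G x" "smooth_euclidean n m U F"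
  shows "smooth_euclidean n m U G"
  unfolding smooth_euclidean_def
proof (intro allI impI)
  fix j k assume "j < m"
  then have "C_diff n k U (\<lambda>x. F x j)" using assms(3) by (simp add: smooth_euclidean_def)
  then show "C_diff n k U (\<lambda>x. G x j)"
    by (rule C_diff_cong[OF assms(1), rotated]) (simp add: assms(2))
qed

lemma smooth_euclidean_subset:
  assumes "openin (Euclidean_space n) U" "openin (Euclidean_space n) N" "N \<subseteq> U"
    "smooth_euclidean n m U F"
  shows "smooth_euclidean n m N F"
  using assms unfolding smooth_euclidean_def by (meson C_diff_subset)

lemma smooth_euclidean_local:
  assumes "openin (Euclidean_space n) U"
    "\<And>x. x \<in> U \<Longrightarrow> \<exists>N. openin (Euclidean_space n) N \<and> x \<in> N \<and> smooth_euclidean n m N F"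
  shows "smooth_euclidean n m U F"
  unfolding smooth_euclidean_def
  by (intro allI impI C_diff_local[OF assms(1)]) (use assms(2) in \<open>metis smooth_euclidean_def\<close>)

lemma smooth_euclidean_compose:
  assumes "openin (Euclidean_space n) U" "openin (Euclidean_space m) V" "F ` U \<subseteq> V"
    "smooth_euclidean n m U F" "smooth_euclidean m l V H"
  shows "smooth_euclidean n l U (H \<circ> F)"
  unfolding smooth_euclidean_def
proof (intro allI impI)
  fix j k assume "j < l"
  have "C_diff n k U (\<lambda>x. (\<lambda>y. H y j) (F x))"
    by (rule C_diff_compose[OF assms(1-3)]) (use assms(4,5) \<open>j < l\<close> in \<open>auto simp: smooth_euclidean_def\<close>)
  then show "C_diff n k U (\<lambda>x. (H \<circ> F) x j)" by simp
qed

lemma smooth_euclidean_const: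
  "openin (Euclidean_space n) U \<Longrightarrow> smooth_euclidean n m U (\<lambda>x. y)"
  by (simp add: smooth_euclidean_def C_diff_const)

section \<open>Charts and their inverses\<close>

lemma is_chart_inj_on: "is_chart n X U c \<Longrightarrow> inj_on c U"
  using homeomorphic_imp_injective_map[of "subtopology X U"] openin_subset
  by (fastforce simp: is_chart_def topspace_subtopology Int_absorb1)

lemma is_chart_subset: "is_chart n X U c \<Longrightarrow> U \<subseteq> topspace X"
  by (simp add: is_chart_def openin_subset)

lemma is_chart_inv_into: "is_chart n X U c \<Longrightarrow> x \<in> U \<Longrightarrow> inv_into U c (c x) = x"
  by (simp add: is_chart_inj_on)

lemma is_chart_openin_image:
  assumes "is_chart n X U c" "openin X N" "N \<subseteq> U"
  shows "openin (Euclidean_space n) (c ` N)"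
proof -
  have "openin (subtopology X U) N"
    using assms by (simp add: openin_open_subtopology is_chart_def)
  then have "openin (subtopology (Euclidean_space n) (c ` U)) (c ` N)"
    using assms homeomorphic_imp_open_map unfolding is_chart_def open_map_def by blast
  then show ?thesis
    using assms(1) openin_trans_full unfolding is_chart_def by blast
qed

lemma is_chart_continuous_map: "is_chart n X U c \<Longrightarrow> continuous_map (subtopology X U) (Euclidean_space n) c"
  by (auto simp: is_chart_def dest!: homeomorphic_imp_continuous_map continuous_map_into_fulltopology)

text \<open>The inverse supplied by the homeomorphism is some function that agrees with
  \<open>inv_into U c\<close> on the chart image; the definitions of smoothness are phrased with the
  latter.\<close>

lemma is_chart_continuous_map_inv:
  assumes "is_chart n X U c"
  shows "continuous_map (subtopology (Euclidean_space n) (c ` U)) X (inv_into U c)"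
proof -
  obtain g where g: "homeomorphic_maps (subtopology X U) (subtopology (Euclidean_space n) (c ` U)) c g"
    using assms by (auto simp: is_chart_def homeomorphic_map_maps)
  have top: "topspace (subtopology X U) = U"
    using is_chart_subset[OF assms] by auto
  have "continuous_map (subtopology (Euclidean_space n) (c ` U)) X g"
    using g continuous_map_into_fulltopology by (auto simp: homeomorphic_maps_def)
  then show ?thesis
  proof (rule continuous_map_eq)
    fix y assume "y \<in> topspace (subtopology (Euclidean_space n) (c ` U))"
    then obtain x where "x \<in> U" "y = c x" by auto
    then show "g y = inv_into U c y"
      using g top is_chart_inv_into[OF assms] by (simp add: homeomorphic_maps_def)
  qed
qed

lemma is_chartI:
  assumes "openin X U" "openin (Euclidean_space n) W"
    and c: "continuous_map (subtopology X U) (Euclidean_space n) c" "\<And>x. x \<in> U \<Longrightarrow> c x \<in> W"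
    and g: "continuous_map (subtopology (Euclidean_space n) W) X g" "\<And>w. w \<in> W \<Longrightarrow> g w \<in> U"
    and gc: "\<And>x. x \<in> U \<Longrightarrow> g (c x) = x" "\<And>w. w \<in> W \<Longrightarrow> c (g w) = w"
  shows "is_chart n X U c" "c ` U = W"
proof -
  show im: "c ` U = W"
    using c(2) g(2) gc(2) by force
  have "homeomorphic_maps (subtopology X U) (subtopology (Euclidean_space n) W) c g"
    unfolding homeomorphic_maps_def continuous_map_in_subtopology
    using c g gc by auto
  then show "is_chart n X U c"
    unfolding is_chart_def im using assms(1,2) homeomorphic_maps_imp_map by blast
qed

text \<open>The fragment of \<open>smooth_manifold\<close> on which most arguments about smooth maps
  run. It leaves out the separation, countability and compatibility conditions, so only charts and
  covering have to be checked for products and open pieces.\<close>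

definition has_atlas :: "'a mfd \<Rightarrow> bool" where
  "has_atlas A \<longleftrightarrow> (\<forall>(U, c) \<in> charts A. is_chart (mdim A) (mtop A) U c) \<and>
     (\<Union>(U, c) \<in> charts A. U) = topspace (mtop A)"

lemma smooth_manifold_has_atlas: "smooth_manifold A \<Longrightarrow> has_atlas A"
  by (simp add: smooth_manifold_def has_atlas_def)

lemma has_atlas_is_chart:
  "has_atlas A \<Longrightarrow> (U, c) \<in> charts A \<Longrightarrow> is_chart (mdim A) (mtop A) U c"
  by (auto simp: has_atlas_def)

lemma has_atlas_cover:
  assumes "has_atlas A" "x \<in> topspace (mtop A)"
  obtains U c where "(U, c) \<in> charts A" "x \<in> U"
  using assms unfolding has_atlas_def by blast

section \<open>Smooth maps: locality, congruence and composition\<close>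

lemma smooth_map_continuous: "smooth_map A B F \<Longrightarrow> continuous_map (mtop A) (mtop B) F"
  by (simp add: smooth_map_def)

lemma smooth_map_image: "smooth_map A B F \<Longrightarrow> x \<in> topspace (mtop A) \<Longrightarrow> F x \<in> topspace (mtop B)"
  using smooth_map_continuous continuous_map_image_subset_topspace by blast

lemma smooth_map_charts:
  "smooth_map A B F \<Longrightarrow> (U, c) \<in> charts A \<Longrightarrow> (V, d) \<in> charts B \<Longrightarrow>
     smooth_euclidean (mdim A) (mdim B) (c ` (U \<inter> F -` V)) (d \<circ> F \<circ> inv_into U c)"
  by (auto simp: smooth_map_def)

lemma openin_Int_vimage:
  assumes "continuous_map X Y F" "openin X U" "openin Y V"
  shows "openin X (U \<inter> F -` V)"
proof -
  have "U \<inter> F -` V = U \<inter> {x \<in> topspace X. F x \<in> V}"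
    using openin_subset[OF assms(2)] by auto
  then show ?thesis
    using openin_continuous_map_preimage[OF assms(1,3)] assms(2) by auto
qed

text \<open>The neighbourhood may depend on the point, which leaves room to choose an auxiliary
  chart near that point; the chart images of the neighbourhoods cover the set on which smoothness is
  required.\<close>

lemma smooth_map_localI:
  assumes A: "has_atlas A" and B: "\<And>V d. (V, d) \<in> charts B \<Longrightarrow> openin (mtop B) V"
    and F: "continuous_map (mtop A) (mtop B) F"
    and loc: "\<And>U c V d x. \<lbrakk>(U, c) \<in> charts A; (V, d) \<in> charts B; x \<in> U; F x \<in> V\<rbrakk> \<Longrightarrow>
      \<exists>N. openin (mtop A) N \<and> x \<in> N \<and> N \<subseteq> U \<and>
        smooth_euclidean (mdim A) (mdim B) (c ` N) (d \<circ> F \<circ> inv_into U c)"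
  shows "smooth_map A B F"
  unfolding smooth_map_def
proof (intro conjI F ballI, clarsimp)
  fix U c V d assume U: "(U, c) \<in> charts A" and V: "(V, d) \<in> charts B"
  note Uc = has_atlas_is_chart[OF A U]
  have op: "openin (mtop A) (U \<inter> F -` V)"
    using openin_Int_vimage[OF F _ B[OF V]] Uc by (simp add: is_chart_def)
  show "smooth_euclidean (mdim A) (mdim B) (c ` (U \<inter> F -` V)) (d \<circ> F \<circ> inv_into U c)"
  proof (rule smooth_euclidean_local)
    show "openin (Euclidean_space (mdim A)) (c ` (U \<inter> F -` V))"
      using is_chart_openin_image[OF Uc op] by simp
    fix y assume "y \<in> c ` (U \<inter> F -` V)"
    then obtain x where x: "x \<in> U" "F x \<in> V" "y = c x" by auto
    then obtain N where N: "openin (mtop A) N" "x \<in> N" "N \<subseteq> U"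
        "smooth_euclidean (mdim A) (mdim B) (c ` N) (d \<circ> F \<circ> inv_into U c)"
      using loc[OF U V] by blast
    then show "\<exists>N. openin (Euclidean_space (mdim A)) N \<and> y \<in> N \<and>
        smooth_euclidean (mdim A) (mdim B) N (d \<circ> F \<circ> inv_into U c)"
      using is_chart_openin_image[OF Uc N(1,3)] x(3) by blast
  qed
qed

lemma smooth_map_cong:
  assumes A: "has_atlas A" and B: "has_atlas B" and "smooth_map A B F"
    and eq: "\<And>x. x \<in> topspace (mtop A) \<Longrightarrow> F x = G x"
  shows "smooth_map A B G"
proof (rule smooth_map_localI[OF A])
  show "openin (mtop B) V" if "(V, d) \<in> charts B" for V d
    using has_atlas_is_chart[OF B that] by (simp add: is_chart_def)
  show "continuous_map (mtop A) (mtop B) G"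
    using continuous_map_eq[OF smooth_map_continuous[OF assms(3)]] eq by blast
  fix U c V d x
  assume U: "(U, c) \<in> charts A" and V: "(V, d) \<in> charts B" and x: "x \<in> U" "G x \<in> V"
  note Uc = has_atlas_is_chart[OF A U]
  have sub: "U \<subseteq> topspace (mtop A)" using is_chart_subset[OF Uc] .
  have N: "openin (mtop A) (U \<inter> F -` V)"
    using openin_Int_vimage[OF smooth_map_continuous[OF assms(3)]] Uc has_atlas_is_chart[OF B V]
    by (simp add: is_chart_def)
  have "smooth_euclidean (mdim A) (mdim B) (c ` (U \<inter> F -` V)) (d \<circ> G \<circ> inv_into U c)"
    by (rule smooth_euclidean_cong[OF _ _ smooth_map_charts[OF assms(3) U V]])
       (use is_chart_openin_image[OF Uc N] is_chart_inv_into[OF Uc] eq sub in auto)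
  then show "\<exists>N. openin (mtop A) N \<and> x \<in> N \<and> N \<subseteq> U \<and>
      smooth_euclidean (mdim A) (mdim B) (c ` N) (d \<circ> G \<circ> inv_into U c)"
    using N x eq sub by (intro exI[of _ "U \<inter> F -` V"]) auto
qed

text \<open>No single chart of \<open>B\<close> need contain the image of \<open>U\<close>. Around
  each point the domain is shrunk until \<open>F\<close> maps it into one chart
  \<open>(V, d)\<close>; there the map read in charts factors through \<open>d\<close> as a
  composite of two smooth Euclidean maps.\<close>

lemma smooth_map_compose:
  assumes A: "has_atlas A" and B: "has_atlas B" and C: "has_atlas C"
    and F: "smooth_map A B F" and G: "smooth_map B C G"
  shows "smooth_map A C (\<lambda>x. G (F x))"
proof (rule smooth_map_localI[OF A])
  show "openin (mtop C) V" if "(V, d) \<in> charts C" for V d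
    using has_atlas_is_chart[OF C that] by (simp add: is_chart_def)
  show cont: "continuous_map (mtop A) (mtop C) (\<lambda>x. G (F x))"
    using continuous_map_compose[OF smooth_map_continuous[OF F] smooth_map_continuous[OF G]]
    by (simp add: o_def)
  fix U c W e x
  assume U: "(U, c) \<in> charts A" and W: "(W, e) \<in> charts C" and x: "x \<in> U" "G (F x) \<in> W"
  note Uc = has_atlas_is_chart[OF A U] and We = has_atlas_is_chart[OF C W]
  have Fx: "F x \<in> topspace (mtop B)"
    using smooth_map_image[OF F] is_chart_subset[OF Uc] x(1) by blast
  obtain V d where V: "(V, d) \<in> charts B" "F x \<in> V"
    by (rule has_atlas_cover[OF B Fx])
  note Vd = has_atlas_is_chart[OF B V(1)]
  have openV: "openin (mtop B) (V \<inter> G -` W)"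
    using openin_Int_vimage[OF smooth_map_continuous[OF G]] Vd We by (simp add: is_chart_def)
  define N where "N = U \<inter> F -` (V \<inter> G -` W)"
  have N: "openin (mtop A) N" "N \<subseteq> U" 
    using openin_Int_vimage[OF smooth_map_continuous[OF F] _ openV] Uc
    by (auto simp: is_chart_def N_def)
  have N': "openin (mtop A) (U \<inter> F -` V)"
    using openin_Int_vimage[OF smooth_map_continuous[OF F]] Uc Vd by (simp add: is_chart_def)
  note cN = is_chart_openin_image[OF Uc N]
  have "smooth_euclidean (mdim A) (mdim C) (c ` N) ((e \<circ> G \<circ> inv_into V d) \<circ> (d \<circ> F \<circ> inv_into U c))"
  proof (rule smooth_euclidean_compose[OF cN])
    show "openin (Euclidean_space (mdim B)) (d ` (V \<inter> G -` W))"
      by (rule is_chart_openin_image[OF Vd openV]) simp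
    show "(d \<circ> F \<circ> inv_into U c) ` c ` N \<subseteq> d ` (V \<inter> G -` W)"
      using is_chart_inv_into[OF Uc] N(2) by (auto simp: N_def)
    show "smooth_euclidean (mdim A) (mdim B) (c ` N) (d \<circ> F \<circ> inv_into U c)"
      by (rule smooth_euclidean_subset[OF is_chart_openin_image[OF Uc N'] cN _ smooth_map_charts[OF F U V(1)]])
         (auto simp: N_def)
    show "smooth_euclidean (mdim B) (mdim C) (d ` (V \<inter> G -` W)) (e \<circ> G \<circ> inv_into V d)"
      by (rule smooth_map_charts[OF G V(1) W])
  qed
  then have "smooth_euclidean (mdim A) (mdim C) (c ` N) (e \<circ> (\<lambda>x. G (F x)) \<circ> inv_into U c)"
    by (rule smooth_euclidean_cong[OF cN, rotated])
       (use is_chart_inv_into[OF Uc] is_chart_inv_into[OF Vd] in \<open>auto simp: N_def\<close>)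
  then show "\<exists>N. openin (mtop A) N \<and> x \<in> N \<and> N \<subseteq> U \<and>
      smooth_euclidean (mdim A) (mdim C) (c ` N) (e \<circ> (\<lambda>x. G (F x)) \<circ> inv_into U c)"
    using N x V by (intro exI[of _ N]) (auto simp: N_def)
qed

text \<open>Read in charts the identity is a transition map, so this is precisely the compatibility
  condition of the atlas, which \<open>has_atlas\<close> does not contain.\<close>

lemma smooth_map_id:
  assumes "smooth_manifold A"
  shows "smooth_map A A (\<lambda>x. x)"
  using assms by (auto simp: smooth_map_def smooth_manifold_def o_def)

lemma smooth_map_const:
  assumes A: "has_atlas A" and B: "has_atlas B" and y: "y \<in> topspace (mtop B)"
  shows "smooth_map A B (\<lambda>x. y)"
proof -
  have "smooth_euclidean (mdim A) (mdim B) (c ` (U \<inter> (\<lambda>x. y) -` V)) (d \<circ> (\<lambda>x. y) \<circ> inv_into U c)"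
    if "(U, c) \<in> charts A" "(V, d) \<in> charts B" for U c V d
    using is_chart_openin_image[OF has_atlas_is_chart[OF A that(1)],
        OF openin_Int_vimage[of "mtop A" "mtop B" "\<lambda>x. y" U V]]
      has_atlas_is_chart[OF A that(1)] has_atlas_is_chart[OF B that(2)] y
    by (simp add: o_def smooth_euclidean_const is_chart_def)
  then show ?thesis
    using y by (auto simp: smooth_map_def)
qed

section \<open>Product manifolds\<close>

lemma continuous_map_append_coords:
  assumes "continuous_map X (Euclidean_space n) f" "continuous_map X (Euclidean_space m) g"
  shows "continuous_map X (Euclidean_space (n + m)) (\<lambda>x. append_coords n (f x) (g x))"
  using assms unfolding continuous_map_into_Euclidean_space
  by (auto simp: append_coords_def)

lemma is_chart_prod:
  assumes U: "is_chart n X U c" and V: "is_chart m Y V d"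
  shows "is_chart (n + m) (prod_topology X Y) (U \<times> V) (\<lambda>(x, y). append_coords n (c x) (d y))"
proof -
  \<comment> \<open>The two coordinate blocks of a point. The first must be cut off at
    \<open>n\<close> to land in Euclidean space; the second needs no cut, as a point of dimension
    \<open>n + m\<close> vanishes from \<open>n + m\<close> on.\<close>
  define l where "l z = (\<lambda>i. if i < n then z i else (0::real))" for z
  define r where "r z = (\<lambda>i. z (n + i) :: real)" for z
  have l: "continuous_map (Euclidean_space (n + m)) (Euclidean_space n) l"
    unfolding continuous_map_into_Euclidean_space l_def
    by (auto simp: continuous_map_Euclidean_space_coord)
  have r: "continuous_map (Euclidean_space (n + m)) (Euclidean_space m) r"
    unfolding continuous_map_into_Euclidean_space r_def
    by (auto simp: continuous_map_Euclidean_space_coord topspace_Euclidean_space)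
  have cE: "c ` U \<subseteq> topspace (Euclidean_space n)" "d ` V \<subseteq> topspace (Euclidean_space m)"
    using U V openin_subset unfolding is_chart_def by blast+
  have lr: "l (append_coords n (c x) (d y)) = c x" "r (append_coords n (c x) (d y)) = d y"
    if "x \<in> U" for x y
    using cE(1) that by (auto simp: l_def r_def append_coords_def topspace_Euclidean_space fun_eq_iff image_subset_iff)
  have ap: "append_coords n (l z) (r z) = z" for z
    by (auto simp: l_def r_def append_coords_def)
  define W where "W = topspace (Euclidean_space (n + m)) \<inter> l -` (c ` U) \<inter> r -` (d ` V)"
  have W: "openin (Euclidean_space (n + m)) W"
    unfolding W_def using U V by (intro openin_Int_vimage[OF r] openin_Int_vimage[OF l]) (auto simp: is_chart_def)
  show ?thesis
  proof (rule is_chartI(1)[where W = W and g = "\<lambda>z. (inv_into U c (l z), inv_into V d (r z))"])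
    show "openin (prod_topology X Y) (U \<times> V)"
      using U V by (simp add: is_chart_def openin_prod_Times_iff)
    have "continuous_map (subtopology (prod_topology X Y) (U \<times> V)) (Euclidean_space n) (\<lambda>p. c (fst p))"
      "continuous_map (subtopology (prod_topology X Y) (U \<times> V)) (Euclidean_space m) (\<lambda>p. d (snd p))"
      using continuous_map_compose[OF continuous_map_fst is_chart_continuous_map[OF U], of "subtopology Y V"]
        continuous_map_compose[OF continuous_map_snd is_chart_continuous_map[OF V], of "subtopology X U"]
      by (simp_all add: subtopology_Times o_def)
    then show "continuous_map (subtopology (prod_topology X Y) (U \<times> V)) (Euclidean_space (n + m))
        (\<lambda>(x, y). append_coords n (c x) (d y))"
      using continuous_map_append_coords by (simp add: case_prod_unfold)
    show "(case p of (x, y) \<Rightarrow> append_coords n (c x) (d y)) \<in> W" if "p \<in> U \<times> V" for p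
      using that lr cE by (auto simp: W_def append_coords_def topspace_Euclidean_space image_subset_iff)
    have "continuous_map (subtopology (Euclidean_space (n + m)) W) (subtopology (Euclidean_space n) (c ` U)) l"
      "continuous_map (subtopology (Euclidean_space (n + m)) W) (subtopology (Euclidean_space m) (d ` V)) r"
      using l r by (auto simp: continuous_map_in_subtopology continuous_map_from_subtopology W_def)
    from continuous_map_compose[OF this(1) is_chart_continuous_map_inv[OF U]]
      continuous_map_compose[OF this(2) is_chart_continuous_map_inv[OF V]]
    show "continuous_map (subtopology (Euclidean_space (n + m)) W) (prod_topology X Y)
        (\<lambda>z. (inv_into U c (l z), inv_into V d (r z)))"
      by (simp add: continuous_map_pairwise o_def)
    show "(inv_into U c (l w), inv_into V d (r w)) \<in> U \<times> V" if "w \<in> W" for w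
      using that by (auto simp: W_def intro: inv_into_into)
    show "(case (inv_into U c (l w), inv_into V d (r w)) of (x, y) \<Rightarrow> append_coords n (c x) (d y)) = w"
      if "w \<in> W" for w
      using that by (auto simp: W_def f_inv_into_f ap)
  qed (use W lr is_chart_inv_into[OF U] is_chart_inv_into[OF V] in auto)
qed

lemma has_atlas_prod:
  assumes A: "has_atlas A" and B: "has_atlas B"
  shows "has_atlas (prod_mfd A B)"
  unfolding has_atlas_def
proof
  show "\<forall>(U, c)\<in>charts (prod_mfd A B). is_chart (mdim (prod_mfd A B)) (mtop (prod_mfd A B)) U c"
    using is_chart_prod[OF has_atlas_is_chart[OF A] has_atlas_is_chart[OF B]]
    by (auto simp: prod_mfd_def)
  have "(\<Union>(W, e)\<in>charts (prod_mfd A B). W) = (\<Union>(U, c)\<in>charts A. U) \<times> (\<Union>(V, d)\<in>charts B. V)"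
    by (auto simp: prod_mfd_def) blast
  then show "(\<Union>(W, e)\<in>charts (prod_mfd A B). W) = topspace (mtop (prod_mfd A B))"
    using A B by (simp add: has_atlas_def prod_mfd_def)
qed

lemma smooth_map_Pair:
  assumes A: "has_atlas A" and B: "has_atlas B" and C: "has_atlas C"
    and F: "smooth_map A B F" and G: "smooth_map A C G"
  shows "smooth_map A (prod_mfd B C) (\<lambda>x. (F x, G x))"
proof (rule smooth_map_localI[OF A])
  show "openin (mtop (prod_mfd B C)) V" if "(V, d) \<in> charts (prod_mfd B C)" for V d
    using has_atlas_is_chart[OF has_atlas_prod[OF B C] that] by (simp add: is_chart_def)
  show "continuous_map (mtop A) (mtop (prod_mfd B C)) (\<lambda>x. (F x, G x))"
    using smooth_map_continuous[OF F] smooth_map_continuous[OF G]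
    by (simp add: prod_mfd_def continuous_map_pairwise o_def)
  fix U c W e x
  assume U: "(U, c) \<in> charts A" and "(W, e) \<in> charts (prod_mfd B C)" and x: "x \<in> U" "(F x, G x) \<in> W"
  then obtain V d V' d' where V: "(V, d) \<in> charts B" "(V', d') \<in> charts C"
    and W: "W = V \<times> V'" "e = (\<lambda>(x, y). append_coords (mdim B) (d x) (d' y))"
    by (auto simp: prod_mfd_def)
  note Uc = has_atlas_is_chart[OF A U]
  have o: "openin (mtop A) (U \<inter> F -` V)" "openin (mtop A) (U \<inter> G -` V')"
    using openin_Int_vimage[OF smooth_map_continuous[OF F]] openin_Int_vimage[OF smooth_map_continuous[OF G]]
      Uc has_atlas_is_chart[OF B V(1)] has_atlas_is_chart[OF C V(2)]
    by (simp_all add: is_chart_def)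
  define N where "N = (U \<inter> F -` V) \<inter> (U \<inter> G -` V')"
  have N: "openin (mtop A) N" "N \<subseteq> U" using o by (auto simp: N_def)
  note cN = is_chart_openin_image[OF Uc N]
  have "smooth_euclidean (mdim A) (mdim B) (c ` N) (d \<circ> F \<circ> inv_into U c)"
    by (rule smooth_euclidean_subset[OF is_chart_openin_image[OF Uc o(1)] cN _ smooth_map_charts[OF F U V(1)]])
       (auto simp: N_def)
  moreover have "smooth_euclidean (mdim A) (mdim C) (c ` N) (d' \<circ> G \<circ> inv_into U c)"
    by (rule smooth_euclidean_subset[OF is_chart_openin_image[OF Uc o(2)] cN _ smooth_map_charts[OF G U V(2)]])
       (auto simp: N_def)
  ultimately have "C_diff (mdim A) k (c ` N) (\<lambda>y. (e \<circ> (\<lambda>x. (F x, G x)) \<circ> inv_into U c) y j)"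
    if "j < mdim B + mdim C" for j k
    using that by (cases "j < mdim B") (simp_all add: smooth_euclidean_def W(2) append_coords_def)
  then have "smooth_euclidean (mdim A) (mdim (prod_mfd B C)) (c ` N) (e \<circ> (\<lambda>x. (F x, G x)) \<circ> inv_into U c)"
    unfolding smooth_euclidean_def prod_mfd_def by simp
  then show "\<exists>N. openin (mtop A) N \<and> x \<in> N \<and> N \<subseteq> U \<and>
      smooth_euclidean (mdim A) (mdim (prod_mfd B C)) (c ` N) (e \<circ> (\<lambda>x. (F x, G x)) \<circ> inv_into U c)"
    using N x W by (intro exI[of _ N]) (auto simp: N_def)
qed

lemma smooth_euclidean_coords:
  assumes "openin (Euclidean_space n) U" "\<And>j. j < m \<Longrightarrow> \<exists>i. \<forall>x. F x j = x i"
  shows "smooth_euclidean n m U F"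
  unfolding smooth_euclidean_def
proof (intro allI impI)
  fix j k assume "j < m"
  then obtain i where "\<And>x. F x j = x i" using assms(2) by blast
  then show "C_diff n k U (\<lambda>x. F x j)" using C_diff_coord[OF assms(1)] by simp
qed

text \<open>The target chart is arbitrary and need not be the first factor of the product chart at
  the source. In charts the map is the block projection followed by a transition map of
  \<open>A\<close>, which is why \<open>A\<close> has to be a manifold with compatible
  charts.\<close>

lemma smooth_map_fst:
  assumes A': "smooth_manifold A" and B: "has_atlas B"
  shows "smooth_map (prod_mfd A B) A fst"
proof -
  note A = smooth_manifold_has_atlas[OF A']
  show ?thesis
  proof (rule smooth_map_localI[OF has_atlas_prod[OF A B]])
    show "openin (mtop A) V" if "(V, d) \<in> charts A" for V d
      using has_atlas_is_chart[OF A that] by (simp add: is_chart_def)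
    show "continuous_map (mtop (prod_mfd A B)) (mtop A) fst"
      by (simp add: prod_mfd_def continuous_map_fst)
    fix W e U' c' p
    assume W: "(W, e) \<in> charts (prod_mfd A B)" and U': "(U', c') \<in> charts A" and p: "p \<in> W" "fst p \<in> U'"
    obtain U c V d where U: "(U, c) \<in> charts A" and V: "(V, d) \<in> charts B"
      and We: "W = U \<times> V" "e = (\<lambda>(x, y). append_coords (mdim A) (c x) (d y))"
      using W by (auto simp: prod_mfd_def)
    note Uc = has_atlas_is_chart[OF A U] and Vd = has_atlas_is_chart[OF B V]
      and Uc' = has_atlas_is_chart[OF A U'] and ch = has_atlas_is_chart[OF has_atlas_prod[OF A B] W]
    have UU': "openin (mtop A) (U \<inter> U')"
      using Uc Uc' by (auto simp: is_chart_def)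
    define N where "N = (U \<inter> U') \<times> V"
    have N: "openin (mtop (prod_mfd A B)) N" "N \<subseteq> W"
      using UU' Vd by (auto simp: N_def We is_chart_def prod_mfd_def openin_prod_Times_iff)
    note eN = is_chart_openin_image[OF ch N]
    define l where "l z = (\<lambda>i. if i < mdim A then z i else (0::real))" for z
    have l: "l (append_coords (mdim A) (c x) w) = c x" if "x \<in> U" for x w
      using openin_subset[of "Euclidean_space (mdim A)" "c ` U"] Uc that
      by (auto simp: l_def append_coords_def topspace_Euclidean_space fun_eq_iff image_subset_iff is_chart_def)
    have "smooth_euclidean (mdim (prod_mfd A B)) (mdim A) (e ` N) ((c' \<circ> (\<lambda>x. x) \<circ> inv_into U c) \<circ> l)"
    proof (rule smooth_euclidean_compose[OF eN])
      show "openin (Euclidean_space (mdim A)) (c ` (U \<inter> (\<lambda>x. x) -` U'))"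
        using is_chart_openin_image[OF Uc UU'] by simp
      show "smooth_euclidean (mdim A) (mdim A) (c ` (U \<inter> (\<lambda>x. x) -` U')) (c' \<circ> (\<lambda>x. x) \<circ> inv_into U c)"
        by (rule smooth_map_charts[OF smooth_map_id[OF A'] U U'])
      show "l ` e ` N \<subseteq> c ` (U \<inter> (\<lambda>x. x) -` U')"
        using l by (auto simp: N_def We)
      show "smooth_euclidean (mdim (prod_mfd A B)) (mdim A) (e ` N) l"
        by (rule smooth_euclidean_coords[OF eN]) (auto simp: l_def)
    qed
    then have "smooth_euclidean (mdim (prod_mfd A B)) (mdim A) (e ` N) (c' \<circ> fst \<circ> inv_into W e)"
    proof (rule smooth_euclidean_cong[OF eN, rotated])
      fix z assume "z \<in> e ` N"
      then obtain x y where "x \<in> U" "y \<in> V" "z = e (x, y)"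
        by (auto simp: N_def)
      then show "((c' \<circ> (\<lambda>x. x) \<circ> inv_into U c) \<circ> l) z = (c' \<circ> fst \<circ> inv_into W e) z"
        using is_chart_inv_into[OF ch, of "(x, y)"] is_chart_inv_into[OF Uc] l by (simp add: We)
    qed
    then show "\<exists>N. openin (mtop (prod_mfd A B)) N \<and> p \<in> N \<and> N \<subseteq> W \<and>
        smooth_euclidean (mdim (prod_mfd A B)) (mdim A) (e ` N) (c' \<circ> fst \<circ> inv_into W e)"
      using N p We by (intro exI[of _ N]) (auto simp: N_def)
  qed
qed

lemma smooth_map_snd:
  assumes A: "has_atlas A" and B': "smooth_manifold B"
  shows "smooth_map (prod_mfd A B) B snd"
proof -
  note B = smooth_manifold_has_atlas[OF B']
  show ?thesis
  proof (rule smooth_map_localI[OF has_atlas_prod[OF A B]])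
    show "openin (mtop B) V" if "(V, d) \<in> charts B" for V d
      using has_atlas_is_chart[OF B that] by (simp add: is_chart_def)
    show "continuous_map (mtop (prod_mfd A B)) (mtop B) snd"
      by (simp add: prod_mfd_def continuous_map_snd)
    fix W e V' d' p
    assume W: "(W, e) \<in> charts (prod_mfd A B)" and V': "(V', d') \<in> charts B" and p: "p \<in> W" "snd p \<in> V'"
    obtain U c V d where U: "(U, c) \<in> charts A" and V: "(V, d) \<in> charts B"
      and We: "W = U \<times> V" "e = (\<lambda>(x, y). append_coords (mdim A) (c x) (d y))"
      using W by (auto simp: prod_mfd_def)
    note Uc = has_atlas_is_chart[OF A U] and Vd = has_atlas_is_chart[OF B V]
      and Vd' = has_atlas_is_chart[OF B V'] and ch = has_atlas_is_chart[OF has_atlas_prod[OF A B] W]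
    have VV': "openin (mtop B) (V \<inter> V')"
      using Vd Vd' by (auto simp: is_chart_def)
    define N where "N = U \<times> (V \<inter> V')"
    have N: "openin (mtop (prod_mfd A B)) N" "N \<subseteq> W"
      using VV' Uc by (auto simp: N_def We is_chart_def prod_mfd_def openin_prod_Times_iff)
    note eN = is_chart_openin_image[OF ch N]
    define r where "r z = (\<lambda>i. z (mdim A + i) :: real)" for z
    have r: "r (append_coords (mdim A) v (d y)) = d y" for v y
      by (auto simp: r_def append_coords_def)
    have "smooth_euclidean (mdim (prod_mfd A B)) (mdim B) (e ` N) ((d' \<circ> (\<lambda>x. x) \<circ> inv_into V d) \<circ> r)"
    proof (rule smooth_euclidean_compose[OF eN])
      show "openin (Euclidean_space (mdim B)) (d ` (V \<inter> (\<lambda>x. x) -` V'))"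
        using is_chart_openin_image[OF Vd VV'] by simp
      show "smooth_euclidean (mdim B) (mdim B) (d ` (V \<inter> (\<lambda>x. x) -` V')) (d' \<circ> (\<lambda>x. x) \<circ> inv_into V d)"
        by (rule smooth_map_charts[OF smooth_map_id[OF B'] V V'])
      show "r ` e ` N \<subseteq> d ` (V \<inter> (\<lambda>x. x) -` V')"
        using r by (auto simp: N_def We)
      show "smooth_euclidean (mdim (prod_mfd A B)) (mdim B) (e ` N) r"
        by (rule smooth_euclidean_coords[OF eN]) (auto simp: r_def)
    qed
    then have "smooth_euclidean (mdim (prod_mfd A B)) (mdim B) (e ` N) (d' \<circ> snd \<circ> inv_into W e)"
    proof (rule smooth_euclidean_cong[OF eN, rotated])
      fix z assume "z \<in> e ` N"
      then obtain x y where "x \<in> U" "y \<in> V" "z = e (x, y)"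
        by (auto simp: N_def)
      then show "((d' \<circ> (\<lambda>x. x) \<circ> inv_into V d) \<circ> r) z = (d' \<circ> snd \<circ> inv_into W e) z"
        using is_chart_inv_into[OF ch, of "(x, y)"] is_chart_inv_into[OF Vd] r by (simp add: We)
    qed
    then show "\<exists>N. openin (mtop (prod_mfd A B)) N \<and> p \<in> N \<and> N \<subseteq> W \<and>
        smooth_euclidean (mdim (prod_mfd A B)) (mdim B) (e ` N) (d' \<circ> snd \<circ> inv_into W e)"
      using N p We by (intro exI[of _ N]) (auto simp: N_def)
  qed
qed

section \<open>Open submanifolds\<close>

lemma is_chart_restrict:
  assumes Uc: "is_chart n X U c" and W: "openin X W"
  shows "is_chart n (subtopology X W) (U \<inter> W) c"
proof (rule is_chartI(1)[where W = "c ` (U \<inter> W)" and g = "inv_into U c"])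
  have UW: "openin X (U \<inter> W)" using Uc W by (auto simp: is_chart_def)
  show "openin (subtopology X W) (U \<inter> W)"
    using UW W by (simp add: openin_open_subtopology)
  show "openin (Euclidean_space n) (c ` (U \<inter> W))"
    using is_chart_openin_image[OF Uc UW] by simp
  show "continuous_map (subtopology (subtopology X W) (U \<inter> W)) (Euclidean_space n) c"
    using continuous_map_from_subtopology_mono[OF is_chart_continuous_map[OF Uc], of "U \<inter> W"]
    by (simp add: subtopology_subtopology inf_commute inf_left_commute)
  have "continuous_map (subtopology (Euclidean_space n) (c ` (U \<inter> W))) X (inv_into U c)"
    using continuous_map_from_subtopology_mono[OF is_chart_continuous_map_inv[OF Uc], of "c ` (U \<inter> W)"]
    by blast
  then show "continuous_map (subtopology (Euclidean_space n) (c ` (U \<inter> W))) (subtopology X W) (inv_into U c)"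
    using is_chart_inv_into[OF Uc] by (auto simp: continuous_map_in_subtopology)
qed (use is_chart_inv_into[OF Uc] in auto)

lemma has_atlas_open_submfd:
  assumes A: "has_atlas A" and W: "openin (mtop A) W"
  shows "has_atlas (open_submfd A W)"
proof -
  have "(\<Union>(U, c)\<in>charts (open_submfd A W). U) = (\<Union>(U, c)\<in>charts A. U) \<inter> W"
    by (auto simp: open_submfd_def)
  then show ?thesis
    using is_chart_restrict[OF has_atlas_is_chart[OF A] W] A
    by (auto simp: has_atlas_def open_submfd_def)
qed

lemma open_submfd_open_submfd:
  "open_submfd (open_submfd A V) W = open_submfd A (V \<inter> W)"
  by (simp add: open_submfd_def subtopology_subtopology image_image case_prod_unfold Int_assoc)

lemma smooth_map_into_open_submfd:
  assumes A: "has_atlas A" and F: "\<And>x. x \<in> topspace (mtop A) \<Longrightarrow> F x \<in> W"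
  shows "smooth_map A (open_submfd B W) F \<longleftrightarrow> smooth_map A B F"
proof -
  have "U \<inter> F -` (V \<inter> W) = U \<inter> F -` V" if "(U, c) \<in> charts A" for U c V
    using F is_chart_subset[OF has_atlas_is_chart[OF A that]] by auto
  then show ?thesis
    using F unfolding smooth_map_def open_submfd_def
    by (fastforce simp: continuous_map_in_subtopology)
qed

lemma smooth_map_from_open_submfd:
  assumes A: "has_atlas A" and B: "has_atlas B" and W: "openin (mtop A) W" and F: "smooth_map A B F"
  shows "smooth_map (open_submfd A W) B F"
proof (rule smooth_map_localI[OF has_atlas_open_submfd[OF A W]])
  show "openin (mtop B) V" if "(V, d) \<in> charts B" for V d
    using has_atlas_is_chart[OF B that] by (simp add: is_chart_def)
  show "continuous_map (mtop (open_submfd A W)) (mtop B) F"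
    using smooth_map_continuous[OF F] by (simp add: open_submfd_def continuous_map_from_subtopology)
  fix U' c V d x
  assume U': "(U', c) \<in> charts (open_submfd A W)" and V: "(V, d) \<in> charts B" and x: "x \<in> U'" "F x \<in> V"
  then obtain U where U: "(U, c) \<in> charts A" "U' = U \<inter> W"
    by (auto simp: open_submfd_def)
  note Uc = has_atlas_is_chart[OF A U(1)] and Vd = has_atlas_is_chart[OF B V]
  have o: "openin (mtop A) (U \<inter> F -` V)"
    using openin_Int_vimage[OF smooth_map_continuous[OF F]] Uc Vd by (simp add: is_chart_def)
  define N where "N = U \<inter> F -` V \<inter> W"
  have N: "openin (mtop A) N" using o W by (auto simp: N_def)
  have cN: "openin (Euclidean_space (mdim A)) (c ` N)"
    by (rule is_chart_openin_image[OF Uc N]) (auto simp: N_def)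
  have "smooth_euclidean (mdim A) (mdim B) (c ` N) (d \<circ> F \<circ> inv_into U c)"
    by (rule smooth_euclidean_subset[OF is_chart_openin_image[OF Uc o] cN _ smooth_map_charts[OF F U(1) V]])
       (auto simp: N_def)
  \<comment> \<open>The restricted chart inverts \<open>c\<close> on \<open>U'\<close> instead of
    \<open>U\<close>; the two inverses agree on the image of \<open>N\<close>.\<close>
  then have "smooth_euclidean (mdim A) (mdim B) (c ` N) (d \<circ> F \<circ> inv_into U' c)"
    by (rule smooth_euclidean_cong[OF cN, rotated])
       (use is_chart_inv_into[OF Uc] is_chart_inv_into[OF is_chart_restrict[OF Uc W]] U(2) in \<open>auto simp: N_def\<close>)
  then show "\<exists>N. openin (mtop (open_submfd A W)) N \<and> x \<in> N \<and> N \<subseteq> U' \<and>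
      smooth_euclidean (mdim (open_submfd A W)) (mdim B) (c ` N) (d \<circ> F \<circ> inv_into U' c)"
    using N x W U(2) by (intro exI[of _ N]) (auto simp: N_def open_submfd_def openin_open_subtopology)
qed

section \<open>Euclidean space as a manifold, and charts as smooth maps\<close>

lemma has_atlas_euclidean_mfd: "has_atlas (euclidean_mfd n)"
proof -
  have "is_chart n (Euclidean_space n) (topspace (Euclidean_space n)) id"
    by (simp add: is_chart_def)
  then show ?thesis by (simp add: has_atlas_def euclidean_mfd_def)
qed

lemma charts_open_submfd_euclidean:
  assumes "W \<subseteq> topspace (Euclidean_space n)"
  shows "charts (open_submfd (euclidean_mfd n) W) = {(W, id)}"
  using assms by (simp add: open_submfd_def euclidean_mfd_def Int_absorb1)

text \<open>With the identity as the only chart of the source, smoothness in charts is ordinary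
  smoothness. The domain is a separate variable \<open>N\<close> so that it can be supplied in
  another form, such as the chart image of an intersection.\<close>

lemma smooth_map_from_open_euclidean:
  assumes W: "openin (Euclidean_space n) W"
    and F: "smooth_map (open_submfd (euclidean_mfd n) W) A F" and V: "(V, d) \<in> charts A"
    and N: "openin (Euclidean_space n) N" "N = W \<inter> F -` V"
  shows "smooth_euclidean n (mdim A) N (d \<circ> F)"
proof -
  have "(W, id) \<in> charts (open_submfd (euclidean_mfd n) W)"
    by (simp add: charts_open_submfd_euclidean openin_subset[OF W])
  from smooth_map_charts[OF F this V]
  have "smooth_euclidean n (mdim A) N (d \<circ> F \<circ> inv_into W id)"
    by (simp add: N(2) open_submfd_def euclidean_mfd_def)
  then show ?thesis
    by (rule smooth_euclidean_cong[OF N(1), rotated]) (use inv_into_f_f[of id W] in \<open>auto simp: N(2)\<close>)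
qed

text \<open>Read in a second chart, the inverse of \<open>d\<close> becomes a transition map, so the
  claim reduces to compatibility of the atlas. The same applies to
  \<open>smooth_map_chart\<close>.\<close>

lemma smooth_map_chart_inv:
  assumes A: "smooth_manifold A" and V: "(V, d) \<in> charts A"
  shows "smooth_map (open_submfd (euclidean_mfd (mdim A)) (d ` V)) A (inv_into V d)"
proof -
  note At = smooth_manifold_has_atlas[OF A]
  note Vd = has_atlas_is_chart[OF At V]
  have dV: "openin (Euclidean_space (mdim A)) (d ` V)" using Vd by (simp add: is_chart_def)
  have cont: "continuous_map (subtopology (Euclidean_space (mdim A)) (d ` V)) (mtop A) (inv_into V d)"
    using is_chart_continuous_map_inv[OF Vd] .
  have "smooth_euclidean (mdim A) (mdim A) (d ` V \<inter> inv_into V d -` U) (c \<circ> inv_into V d \<circ> inv_into (d ` V) id)"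
    if U: "(U, c) \<in> charts A" for U c
  proof -
    have "d ` V \<inter> inv_into V d -` U = d ` (V \<inter> U)"
      using is_chart_inv_into[OF Vd] by auto
    moreover have "openin (Euclidean_space (mdim A)) (d ` (V \<inter> U))"
      using is_chart_openin_image[OF Vd, of "V \<inter> U"] Vd has_atlas_is_chart[OF At U]
      by (auto simp: is_chart_def)
    moreover have "smooth_euclidean (mdim A) (mdim A) (d ` (V \<inter> U)) (c \<circ> inv_into V d)"
      using A U V by (auto simp: smooth_manifold_def)
    ultimately show ?thesis
      by (auto intro!: smooth_euclidean_cong[of _ _ "c \<circ> inv_into V d"] simp: inv_into_f_f[of id, simplified])
  qed
  then show ?thesis
    using cont unfolding smooth_map_def
    by (simp add: charts_open_submfd_euclidean[OF openin_subset[OF dV]])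
       (auto simp: open_submfd_def euclidean_mfd_def)
qed

lemma smooth_map_chart:
  assumes A: "smooth_manifold A" and V: "(V, d) \<in> charts A"
  shows "smooth_map (open_submfd A V) (euclidean_mfd (mdim A)) d"
proof -
  note At = smooth_manifold_has_atlas[OF A]
  note Vd = has_atlas_is_chart[OF At V]
  have oV: "openin (mtop A) V" using Vd by (simp add: is_chart_def)
  have dE: "d x \<in> topspace (Euclidean_space (mdim A))" if "x \<in> V" for x
    using Vd openin_subset that by (fastforce simp: is_chart_def)
  have "smooth_euclidean (mdim A) (mdim A) (c ` (U \<inter> V \<inter> d -` topspace (Euclidean_space (mdim A)))) (id \<circ> d \<circ> inv_into (U \<inter> V) c)"
    if U: "(U, c) \<in> charts A" for U c
  proof -
    note Uc = has_atlas_is_chart[OF At U]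
    have "U \<inter> V \<inter> d -` topspace (Euclidean_space (mdim A)) = U \<inter> V"
      using dE by auto
    moreover have UV: "openin (Euclidean_space (mdim A)) (c ` (U \<inter> V))"
      using is_chart_openin_image[OF Uc, of "U \<inter> V"] Vd Uc by (auto simp: is_chart_def)
    moreover have "smooth_euclidean (mdim A) (mdim A) (c ` (U \<inter> V)) (d \<circ> inv_into U c)"
      using A U V by (auto simp: smooth_manifold_def)
    then have "smooth_euclidean (mdim A) (mdim A) (c ` (U \<inter> V)) (id \<circ> d \<circ> inv_into (U \<inter> V) c)"
      by (rule smooth_euclidean_cong[OF UV, rotated])
         (use is_chart_inv_into[OF Uc] is_chart_inv_into[OF is_chart_restrict[OF Uc oV]] in auto)
    ultimately show ?thesis by simp
  qed
  then show ?thesis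
    using is_chart_continuous_map[OF Vd] unfolding smooth_map_def
    by (auto simp: open_submfd_def euclidean_mfd_def)
qed

section \<open>Embedded submanifolds\<close>

lemma charts_embedded_submfdD:
  assumes "(U, c) \<in> charts (embedded_submfd A S k)"
  shows "is_chart k (subtopology (mtop A) S) U c"
    and "smooth_map (open_submfd (euclidean_mfd k) (c ` U)) A (inv_into U c)"
    and "x \<in> U \<Longrightarrow> \<exists>W h. openin (mtop A) W \<and> x \<in> W \<and>
           smooth_map (open_submfd A W) (euclidean_mfd k) h \<and> (\<forall>y \<in> U \<inter> W. h y = c y)"
  using assms by (auto simp: embedded_submfd_def)

lemma mtop_embedded_submfd [simp]: "mtop (embedded_submfd A S k) = subtopology (mtop A) S"
  and mdim_embedded_submfd [simp]: "mdim (embedded_submfd A S k) = k"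
  by (simp_all add: embedded_submfd_def)

text \<open>The condition that the inverse of a chart is smooth into \<open>A\<close> is, read in a
  chart of \<open>A\<close>, exactly smoothness of the inclusion.\<close>

lemma smooth_map_embedded_submfd_inclusion:
  assumes A: "has_atlas A"
  shows "smooth_map (embedded_submfd A S k) A (\<lambda>x. x)"
proof -
  have "smooth_euclidean k (mdim A) (c ` (U \<inter> (\<lambda>x. x) -` V)) (d \<circ> (\<lambda>x. x) \<circ> inv_into U c)"
    if U: "(U, c) \<in> charts (embedded_submfd A S k)" and V: "(V, d) \<in> charts A" for U c V d
  proof -
    note Uc = charts_embedded_submfdD(1)[OF U]
    have "openin (subtopology (mtop A) S) (S \<inter> V)"
      using has_atlas_is_chart[OF A V] by (simp add: is_chart_def openin_subtopology_Int2)
    moreover have "U \<inter> V = U \<inter> (S \<inter> V)"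
      using is_chart_subset[OF Uc] by auto
    ultimately have "openin (subtopology (mtop A) S) (U \<inter> V)"
      using Uc by (simp add: is_chart_def openin_Int)
    from is_chart_openin_image[OF Uc this]
    have "smooth_euclidean k (mdim A) (c ` (U \<inter> V)) (d \<circ> inv_into U c)"
      by (intro smooth_map_from_open_euclidean[OF _ charts_embedded_submfdD(2)[OF U] V])
         (use Uc is_chart_inv_into[OF Uc] in \<open>auto simp: is_chart_def\<close>)
    then show ?thesis by (simp add: o_def)
  qed
  then show ?thesis
    by (auto simp: smooth_map_def)
qed

text \<open>This is what the local extensions are for: near a given point a chart \<open>d\<close>
  of \<open>S\<close> may be replaced by a map \<open>h\<close> that is smooth on an open subset of
  \<open>B\<close>, and \<open>h\<close> after \<open>F\<close> is a composite of smooth maps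
  between ordinary manifolds.\<close>

lemma smooth_map_into_embedded_submfd:
  assumes A: "has_atlas A" and B: "has_atlas B" and F: "smooth_map A B F"
    and S: "\<And>x. x \<in> topspace (mtop A) \<Longrightarrow> F x \<in> S"
  shows "smooth_map A (embedded_submfd B S k) F"
proof (rule smooth_map_localI[OF A])
  show "openin (mtop (embedded_submfd B S k)) V" if "(V, d) \<in> charts (embedded_submfd B S k)" for V d
    using charts_embedded_submfdD(1)[OF that] by (simp add: is_chart_def)
  show cont: "continuous_map (mtop A) (mtop (embedded_submfd B S k)) F"
    using smooth_map_continuous[OF F] S by (auto simp: continuous_map_in_subtopology)
  fix U c V d x
  assume U: "(U, c) \<in> charts A" and V: "(V, d) \<in> charts (embedded_submfd B S k)" and x: "x \<in> U" "F x \<in> V"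
  note Uc = has_atlas_is_chart[OF A U]
  note Vd = charts_embedded_submfdD(1)[OF V]
  obtain W h where W: "openin (mtop B) W" "F x \<in> W"
    and h: "smooth_map (open_submfd B W) (euclidean_mfd k) h" "\<forall>y \<in> V \<inter> W. h y = d y"
    using charts_embedded_submfdD(3)[OF V x(2)] by blast
  define O1 where "O1 = topspace (mtop A) \<inter> F -` W"
  have O1: "openin (mtop A) O1"
    unfolding O1_def using openin_Int_vimage[OF smooth_map_continuous[OF F] _ W(1)] by simp
  have topO1: "topspace (mtop (open_submfd A O1)) = O1"
    using openin_subset[OF O1] by (auto simp: open_submfd_def)
  note AO = has_atlas_open_submfd[OF A O1] and BW = has_atlas_open_submfd[OF B W(1)]
  have "smooth_map (open_submfd A O1) (open_submfd B W) F"
    using smooth_map_from_open_submfd[OF A B O1 F] smooth_map_into_open_submfd[OF AO, of F W B] topO1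
    by (auto simp: O1_def)
  note hF = smooth_map_compose[OF AO BW has_atlas_euclidean_mfd this h(1)]
  have c1: "(U \<inter> O1, c) \<in> charts (open_submfd A O1)"
    using U by (auto simp: open_submfd_def)
  have c2: "(topspace (Euclidean_space k), id) \<in> charts (euclidean_mfd k)"
    by (simp add: euclidean_mfd_def)
  have "h (F y) \<in> topspace (Euclidean_space k)" if "y \<in> O1" for y
    using smooth_map_image[OF hF] that topO1 by (simp add: euclidean_mfd_def)
  then have "U \<inter> O1 \<inter> (\<lambda>x. h (F x)) -` topspace (Euclidean_space k) = U \<inter> O1"
    by auto
  with smooth_map_charts[OF hF c1 c2]
  have sm: "smooth_euclidean (mdim A) k (c ` (U \<inter> O1)) (id \<circ> (\<lambda>x. h (F x)) \<circ> inv_into (U \<inter> O1) c)"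
    by (simp add: open_submfd_def euclidean_mfd_def)
  \<comment> \<open>The point must be sent into \<open>W\<close>, where \<open>h\<close> is smooth,
    and also into \<open>V\<close>, where \<open>h\<close> equals the chart
    \<open>d\<close>.\<close>
  define N where "N = U \<inter> O1 \<inter> F -` V"
  have UO: "openin (mtop A) (U \<inter> O1)" using Uc O1 by (auto simp: is_chart_def)
  have N: "openin (mtop A) N" "N \<subseteq> U"
    using openin_Int_vimage[OF cont UO] Vd by (auto simp: N_def is_chart_def)
  note cN = is_chart_openin_image[OF Uc N]
  have "smooth_euclidean (mdim A) k (c ` N) (id \<circ> (\<lambda>x. h (F x)) \<circ> inv_into (U \<inter> O1) c)"
    by (rule smooth_euclidean_subset[OF is_chart_openin_image[OF Uc UO] cN _ sm]) (auto simp: N_def)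
  then have "smooth_euclidean (mdim A) k (c ` N) (d \<circ> F \<circ> inv_into U c)"
    by (rule smooth_euclidean_cong[OF cN, rotated])
       (use is_chart_inv_into[OF Uc] is_chart_inv_into[OF is_chart_restrict[OF Uc O1]] h(2)
         in \<open>auto simp: N_def O1_def\<close>)
  then show "\<exists>N. openin (mtop A) N \<and> x \<in> N \<and> N \<subseteq> U \<and>
      smooth_euclidean (mdim A) (mdim (embedded_submfd B S k)) (c ` N) (d \<circ> F \<circ> inv_into U c)"
    using N x W is_chart_subset[OF Uc] by (intro exI[of _ N]) (auto simp: N_def O1_def)
qed

text \<open>Compatibility of the charts is automatic, so covering is the only condition on
  \<open>S\<close>. The inverse of one chart is smooth into \<open>A\<close> with values in
  \<open>S\<close>, hence smooth into the submanifold by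
  \<open>smooth_map_into_embedded_submfd\<close>; reading it in another chart gives the transition
  map. There is no circle, since that lemma treats the charts one at a time.\<close>

lemma smooth_manifold_embedded_submfd:
  assumes A: "smooth_manifold A"
    and cover: "\<And>x. x \<in> topspace (mtop A) \<inter> S \<Longrightarrow> \<exists>(U, c) \<in> charts (embedded_submfd A S k). x \<in> U"
  shows "smooth_manifold (embedded_submfd A S k)"
proof -
  note At = smooth_manifold_has_atlas[OF A]
  have "smooth_euclidean k k (c ` (U \<inter> V)) (d \<circ> inv_into U c)"
    if U: "(U, c) \<in> charts (embedded_submfd A S k)" and V: "(V, d) \<in> charts (embedded_submfd A S k)" for U c V d
  proof -
    note Uc = charts_embedded_submfdD(1)[OF U] and Vd = charts_embedded_submfdD(1)[OF V]
    have cU: "openin (Euclidean_space k) (c ` U)"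
      using Uc by (simp add: is_chart_def)
    then have at: "has_atlas (open_submfd (euclidean_mfd k) (c ` U))"
      by (intro has_atlas_open_submfd has_atlas_euclidean_mfd) (simp add: euclidean_mfd_def)
    have "inv_into U c y \<in> S" if "y \<in> topspace (mtop (open_submfd (euclidean_mfd k) (c ` U)))" for y
      using that is_chart_inv_into[OF Uc] is_chart_subset[OF Uc] by (auto simp: open_submfd_def)
    from smooth_map_into_embedded_submfd[OF at At charts_embedded_submfdD(2)[OF U] this]
    have sm: "smooth_map (open_submfd (euclidean_mfd k) (c ` U)) (embedded_submfd A S k) (inv_into U c)" .
    have "openin (Euclidean_space k) (c ` (U \<inter> V))"
      using is_chart_openin_image[OF Uc, of "U \<inter> V"] Uc Vd by (auto simp: is_chart_def)
    moreover have "c ` (U \<inter> V) = c ` U \<inter> inv_into U c -` V"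
      using is_chart_inv_into[OF Uc] by auto
    ultimately show ?thesis
      using smooth_map_from_open_euclidean[OF cU sm V] by simp
  qed
  moreover have "(\<Union>(U, c)\<in>charts (embedded_submfd A S k). U) = topspace (mtop A) \<inter> S"
  proof
    show "(\<Union>(U, c)\<in>charts (embedded_submfd A S k). U) \<subseteq> topspace (mtop A) \<inter> S"
      using is_chart_subset[OF charts_embedded_submfdD(1)] by fastforce
    show "topspace (mtop A) \<inter> S \<subseteq> (\<Union>(U, c)\<in>charts (embedded_submfd A S k). U)"
      using cover by fastforce
  qed
  moreover have "Hausdorff_space (subtopology (mtop A) S)" "second_countable (subtopology (mtop A) S)"
    using A by (auto simp: smooth_manifold_def Hausdorff_space_subtopology second_countable_subtopology)
  ultimately show ?thesis
    using charts_embedded_submfdD(1) by (auto simp: smooth_manifold_def)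
qed

text \<open>\<open>S\<close> is parametrized by the smooth map \<open>s\<close>, whose inverse on
  \<open>S\<close> is the restriction of a map \<psi> that is smooth on an open set around
  \<open>S\<close>. Each chart \<open>d\<close> of \<open>G\<close> then gives the chart
  \<open>d \<circ> \<psi>\<close> of \<open>S\<close>. The diffeomorphism property follows by
  composing \<psi> with the inclusion and by viewing \<open>s\<close> as a map into
  \<open>S\<close>.\<close>

lemma embedded_submfd_diffeomorphism:
  assumes P: "smooth_manifold P" and G: "smooth_manifold G"
    and O1: "openin (mtop P) O1" and S: "S \<subseteq> O1"
    and \<psi>: "smooth_map (open_submfd P O1) G \<psi>" and s: "smooth_map G P s"
    and sS: "\<And>g. g \<in> topspace (mtop G) \<Longrightarrow> s g \<in> S \<and> \<psi> (s g) = g"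
    and s\<psi>: "\<And>p. p \<in> S \<Longrightarrow> s (\<psi> p) = p"
  shows "smooth_manifold (embedded_submfd P S (mdim G))"
    and "diffeomorphism (embedded_submfd P S (mdim G)) G \<psi>"
proof -
  note Pt = smooth_manifold_has_atlas[OF P] and Gt = smooth_manifold_has_atlas[OF G]
  note POt = has_atlas_open_submfd[OF Pt O1]
  let ?F = "embedded_submfd P S (mdim G)"
  have OP: "O1 \<subseteq> topspace (mtop P)" using openin_subset[OF O1] .
  have top: "topspace (mtop ?F) = S" using S OP by auto
  have mtopO: "mtop (open_submfd P O1) = subtopology (mtop P) O1"
    by (simp add: open_submfd_def)
  have contO: "continuous_map (subtopology (mtop P) O1) (mtop G) \<psi>"
    using smooth_map_continuous[OF \<psi>] by (simp add: mtopO)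
  have contS: "continuous_map (subtopology (mtop P) S) (mtop G) \<psi>"
    using continuous_map_from_subtopology_mono[OF contO S] .
  have \<psi>G: "\<psi> p \<in> topspace (mtop G)" if "p \<in> S" for p
    using continuous_map_image_subset_topspace[OF contS] that top by auto
  have chart: "(S \<inter> \<psi> -` V, d \<circ> \<psi>) \<in> charts ?F" if V: "(V, d) \<in> charts G" for V d
  proof -
    note Vd = has_atlas_is_chart[OF Gt V]
    have VG: "V \<subseteq> topspace (mtop G)" using is_chart_subset[OF Vd] .
    have oV: "openin (mtop G) V" and dV: "openin (Euclidean_space (mdim G)) (d ` V)"
      using Vd by (simp_all add: is_chart_def)
    let ?U = "S \<inter> \<psi> -` V" and ?c = "d \<circ> \<psi>" and ?g = "\<lambda>w. s (inv_into V d w)"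
    have "openin (subtopology (mtop P) S) ?U"
      using openin_Int_vimage[OF contS _ oV, of S] top by (metis mtop_embedded_submfd openin_topspace)
    moreover have "continuous_map (subtopology (subtopology (mtop P) S) ?U) (Euclidean_space (mdim G)) ?c"
    proof (rule continuous_map_compose[OF _ is_chart_continuous_map[OF Vd]])
      show "continuous_map (subtopology (subtopology (mtop P) S) ?U) (subtopology (mtop G) V) \<psi>"
        using continuous_map_from_subtopology[OF contS] by (auto simp: continuous_map_in_subtopology)
    qed
    moreover have cg: "continuous_map (subtopology (Euclidean_space (mdim G)) (d ` V)) (mtop P) ?g"
      using continuous_map_compose[OF is_chart_continuous_map_inv[OF Vd] smooth_map_continuous[OF s]]
      by (simp add: o_def)
    then have "continuous_map (subtopology (Euclidean_space (mdim G)) (d ` V)) (subtopology (mtop P) S) ?g"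
      using sS VG is_chart_inv_into[OF Vd] by (auto simp: continuous_map_in_subtopology)
    moreover have gU: "?g w \<in> ?U" and cgw: "?c (?g w) = w" if "w \<in> d ` V" for w
      using that sS VG is_chart_inv_into[OF Vd] by auto
    moreover have gc: "?g (?c x) = x" if "x \<in> ?U" for x
      using that is_chart_inv_into[OF Vd] s\<psi> by simp
    ultimately have ch: "is_chart (mdim G) (subtopology (mtop P) S) ?U ?c" and im: "?c ` ?U = d ` V"
      using is_chartI[of "subtopology (mtop P) S" ?U "mdim G" "d ` V" ?c ?g] dV by auto
    \<comment> \<open>The definition of the charts of a submanifold speaks of
      \<open>inv_into\<close>, which agrees with the explicit inverse on the chart image.\<close>
    have inv_eq: "?g w = inv_into ?U ?c w" if "w \<in> d ` V" for w
      using is_chart_inv_into[OF ch gU[OF that]] cgw[OF that] by simp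
    have oE: "has_atlas (open_submfd (euclidean_mfd (mdim G)) (d ` V))"
      using dV by (intro has_atlas_open_submfd has_atlas_euclidean_mfd) (simp add: euclidean_mfd_def)
    have "smooth_map (open_submfd (euclidean_mfd (mdim G)) (d ` V)) P ?g"
      by (rule smooth_map_compose[OF oE Gt Pt smooth_map_chart_inv[OF G V] s])
    then have "smooth_map (open_submfd (euclidean_mfd (mdim G)) (d ` V)) P (inv_into ?U ?c)"
      by (rule smooth_map_cong[OF oE Pt]) (simp add: open_submfd_def inv_eq)
    \<comment> \<open>The chart is its own local extension: \<psi> is already smooth off
      \<open>S\<close>, so \<open>d \<circ> \<psi>\<close> works on the part of \<open>O1\<close>
      that \<psi> maps into \<open>V\<close>.\<close>
    moreover have "\<exists>W h. openin (mtop P) W \<and> x \<in> W \<and>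
           smooth_map (open_submfd P W) (euclidean_mfd (mdim G)) h \<and> (\<forall>y \<in> ?U \<inter> W. h y = ?c y)"
      if x: "x \<in> ?U" for x
    proof (intro exI conjI)
      let ?W = "O1 \<inter> \<psi> -` V"
      have W': "openin (subtopology (mtop P) O1) ?W"
        using openin_Int_vimage[OF contO _ oV, of O1] O1 OP by (simp add: openin_open_subtopology)
      then show W: "openin (mtop P) ?W"
        using O1 openin_trans_full by blast
      have PW: "open_submfd (open_submfd P O1) ?W = open_submfd P ?W"
        by (simp add: open_submfd_open_submfd)
      have "smooth_map (open_submfd P ?W) G \<psi>"
        using smooth_map_from_open_submfd[OF POt Gt _ \<psi>, of ?W] W' by (simp add: PW mtopO)
      then have "smooth_map (open_submfd P ?W) (open_submfd G V) \<psi>"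
        by (subst smooth_map_into_open_submfd[OF has_atlas_open_submfd[OF Pt W]])
           (auto simp: open_submfd_def)
      then have "smooth_map (open_submfd P ?W) (euclidean_mfd (mdim G)) (\<lambda>x. d (\<psi> x))"
        by (rule smooth_map_compose[OF has_atlas_open_submfd[OF Pt W]
              has_atlas_open_submfd[OF Gt oV] has_atlas_euclidean_mfd _ smooth_map_chart[OF G V]])
      then show "smooth_map (open_submfd P ?W) (euclidean_mfd (mdim G)) ?c"
        by (simp add: o_def)
      show "x \<in> ?W" using x S by auto
    qed simp
    ultimately show ?thesis
      using ch unfolding embedded_submfd_def im[symmetric] by simp
  qed
  show F: "smooth_manifold ?F"
  proof (rule smooth_manifold_embedded_submfd[OF P])
    fix x assume "x \<in> topspace (mtop P) \<inter> S"
    then obtain V d where "(V, d) \<in> charts G" "\<psi> x \<in> V"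
      using has_atlas_cover[OF Gt \<psi>G] by blast
    then show "\<exists>(U, c)\<in>charts ?F. x \<in> U"
      using \<open>x \<in> topspace (mtop P) \<inter> S\<close> by (intro bexI[OF _ chart]) auto
  qed
  note Ft = smooth_manifold_has_atlas[OF F]
  have bij: "bij_betw \<psi> S (topspace (mtop G))"
    by (rule bij_betwI[where g = s]) (use \<psi>G sS s\<psi> in auto)
  have "smooth_map ?F (open_submfd P O1) (\<lambda>x. x)"
    using smooth_map_embedded_submfd_inclusion[OF Pt] S top
    by (subst smooth_map_into_open_submfd[OF Ft]) auto
  from smooth_map_compose[OF Ft POt Gt this \<psi>] have "smooth_map ?F G \<psi>" .
  moreover have "smooth_map G ?F s"
    by (rule smooth_map_into_embedded_submfd[OF Gt Pt s]) (use sS in auto)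
  then have "smooth_map G ?F (inv_into S \<psi>)"
    by (rule smooth_map_cong[OF Gt Ft])
       (use sS inv_into_f_f[OF bij_betw_imp_inj_on[OF bij]] in metis)
  ultimately show "diffeomorphism ?F G \<psi>"
    using bij top by (simp add: diffeomorphism_def)
qed

section \<open>Quandles on fibres and groups\<close>

lemma conjugation_inner_automorphism:
  assumes "group G" "a \<in> carrier G"
  shows "inner_automorphism G (\<lambda>g\<in>carrier G. a \<otimes>\<^bsub>G\<^esub> g \<otimes>\<^bsub>G\<^esub> inv\<^bsub>G\<^esub> a)"
proof -
  interpret group G by fact
  \<comment> \<open>Conjugation is restricted to the carrier because members of
    \<open>auto G\<close> are undefined outside it.\<close>
  let ?\<sigma> = "\<lambda>g\<in>carrier G. a \<otimes>\<^bsub>G\<^esub> g \<otimes>\<^bsub>G\<^esub> inv\<^bsub>G\<^esub> a"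
  have cancel: "inv\<^bsub>G\<^esub> a \<otimes>\<^bsub>G\<^esub> (a \<otimes>\<^bsub>G\<^esub> x) = x" "a \<otimes>\<^bsub>G\<^esub> (inv\<^bsub>G\<^esub> a \<otimes>\<^bsub>G\<^esub> x) = x"
    if "x \<in> carrier G" for x
    using that assms(2) by (simp_all flip: m_assoc)
  have "?\<sigma> \<in> hom G G"
    using assms(2) by (auto simp: hom_def m_assoc cancel)
  moreover have "bij_betw ?\<sigma> (carrier G) (carrier G)"
    by (rule bij_betwI[where g = "\<lambda>g. inv\<^bsub>G\<^esub> a \<otimes>\<^bsub>G\<^esub> g \<otimes>\<^bsub>G\<^esub> a"])
       (use assms(2) in \<open>auto simp: m_assoc cancel\<close>)
  ultimately show ?thesis
    using assms(2) by (auto simp: inner_automorphism_def auto_def Bij_def)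
qed

text \<open>Both sides of self-distributivity equal \<open>\<sigma> (\<sigma> (x y\<^sup>-\<^sup>1))
  \<sigma> (y z\<^sup>-\<^sup>1) z\<close>; on the right-hand side the two copies of
  \<open>z\<close> cancel in the quotient. Acting by \<open>x\<close> from the right is bijective
  because it is \<sigma> between two right translations of the group.\<close>

lemma quandle_gen_alexander:
  assumes "group G" "\<sigma> \<in> auto G"
  shows "quandle (carrier G) (gen_alexander G \<sigma>)"
proof -
  interpret group G by fact
  have \<sigma>: "\<sigma> \<in> hom G G" and bij: "bij_betw \<sigma> (carrier G) (carrier G)"
    using assms(2) by (auto simp: auto_def Bij_def)
  interpret \<sigma>: group_hom G G \<sigma>
    by unfold_locales (rule \<sigma>)
  have cancel: "x \<otimes>\<^bsub>G\<^esub> y \<otimes>\<^bsub>G\<^esub> inv\<^bsub>G\<^esub> y = x" "x \<otimes>\<^bsub>G\<^esub> inv\<^bsub>G\<^esub> y \<otimes>\<^bsub>G\<^esub> y = x"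
    if "x \<in> carrier G" "y \<in> carrier G" for x y
    using that by (simp_all add: m_assoc)
  have dist: "gen_alexander G \<sigma> (gen_alexander G \<sigma> x y) z =
      gen_alexander G \<sigma> (gen_alexander G \<sigma> x z) (gen_alexander G \<sigma> y z)"
    if c: "x \<in> carrier G" "y \<in> carrier G" "z \<in> carrier G" for x y z
  proof -
    have inv_yz: "inv\<^bsub>G\<^esub> (\<sigma> (y \<otimes>\<^bsub>G\<^esub> inv\<^bsub>G\<^esub> z) \<otimes>\<^bsub>G\<^esub> z) = inv\<^bsub>G\<^esub> z \<otimes>\<^bsub>G\<^esub> \<sigma> (z \<otimes>\<^bsub>G\<^esub> inv\<^bsub>G\<^esub> y)"
      using c by (simp add: inv_mult_group flip: \<sigma>.hom_inv)
    have "\<sigma> (x \<otimes>\<^bsub>G\<^esub> inv\<^bsub>G\<^esub> z) \<otimes>\<^bsub>G\<^esub> z \<otimes>\<^bsub>G\<^esub> (inv\<^bsub>G\<^esub> z \<otimes>\<^bsub>G\<^esub> \<sigma> (z \<otimes>\<^bsub>G\<^esub> inv\<^bsub>G\<^esub> y))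
        = \<sigma> (x \<otimes>\<^bsub>G\<^esub> inv\<^bsub>G\<^esub> z) \<otimes>\<^bsub>G\<^esub> \<sigma> (z \<otimes>\<^bsub>G\<^esub> inv\<^bsub>G\<^esub> y)"
      using c by (simp add: cancel flip: m_assoc)
    also have "\<dots> = \<sigma> (x \<otimes>\<^bsub>G\<^esub> inv\<^bsub>G\<^esub> z \<otimes>\<^bsub>G\<^esub> (z \<otimes>\<^bsub>G\<^esub> inv\<^bsub>G\<^esub> y))"
      using c by (simp only: \<sigma>.hom_mult m_closed inv_closed)
    also have "x \<otimes>\<^bsub>G\<^esub> inv\<^bsub>G\<^esub> z \<otimes>\<^bsub>G\<^esub> (z \<otimes>\<^bsub>G\<^esub> inv\<^bsub>G\<^esub> y) = x \<otimes>\<^bsub>G\<^esub> inv\<^bsub>G\<^esub> y"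
      using c by (simp add: cancel flip: m_assoc)
    finally have "gen_alexander G \<sigma> (gen_alexander G \<sigma> x z) (gen_alexander G \<sigma> y z)
        = \<sigma> (\<sigma> (x \<otimes>\<^bsub>G\<^esub> inv\<^bsub>G\<^esub> y)) \<otimes>\<^bsub>G\<^esub> (\<sigma> (y \<otimes>\<^bsub>G\<^esub> inv\<^bsub>G\<^esub> z) \<otimes>\<^bsub>G\<^esub> z)"
      by (simp only: gen_alexander_def inv_yz)
    also have "\<dots> = \<sigma> (\<sigma> (x \<otimes>\<^bsub>G\<^esub> inv\<^bsub>G\<^esub> y) \<otimes>\<^bsub>G\<^esub> (y \<otimes>\<^bsub>G\<^esub> inv\<^bsub>G\<^esub> z)) \<otimes>\<^bsub>G\<^esub> z"
      using c by (simp only: \<sigma>.hom_mult \<sigma>.hom_closed m_assoc m_closed inv_closed)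
    also have "\<dots> = gen_alexander G \<sigma> (gen_alexander G \<sigma> x y) z"
      using c by (simp only: gen_alexander_def m_assoc m_closed inv_closed \<sigma>.hom_closed)
    finally show ?thesis by simp
  qed
  have idem: "gen_alexander G \<sigma> x x = x" if "x \<in> carrier G" for x
    using that by (simp add: gen_alexander_def)
  have bij_right: "bij_betw (\<lambda>y. gen_alexander G \<sigma> y x) (carrier G) (carrier G)" if x: "x \<in> carrier G" for x
  proof -
    have tr: "bij_betw (\<lambda>y. y \<otimes>\<^bsub>G\<^esub> z) (carrier G) (carrier G)" if "z \<in> carrier G" for z
      by (rule bij_betwI[where g = "\<lambda>y. y \<otimes>\<^bsub>G\<^esub> inv\<^bsub>G\<^esub> z"]) (use that cancel in auto)
    have "bij_betw ((\<lambda>y. y \<otimes>\<^bsub>G\<^esub> x) \<circ> (\<sigma> \<circ> (\<lambda>y. y \<otimes>\<^bsub>G\<^esub> inv\<^bsub>G\<^esub> x))) (carrier G) (carrier G)"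
      using x by (intro bij_betw_trans[OF bij_betw_trans[OF tr bij] tr]) auto
    then show ?thesis by (simp add: o_def gen_alexander_def)
  qed
  have closed: "gen_alexander G \<sigma> x y \<in> carrier G" if "x \<in> carrier G" "y \<in> carrier G" for x y
    using that by (simp add: gen_alexander_def)
  show ?thesis
    unfolding quandle_def
    by (intro conjI ballI; (rule closed | rule dist | rule idem | rule bij_right); assumption)
qed

text \<open>Each axiom is verified after applying the injective map \<open>F\<close>. Closure of
  \<open>X\<close> has to be assumed: the homomorphism equation constrains only the image of
  \<open>q x y\<close> and does not place \<open>q x y\<close> in \<open>X\<close>.\<close>

lemma quandle_transport:
  assumes Y: "quandle Y r" and F: "bij_betw F X Y" and hom: "quandle_hom X q r F"
    and closed: "\<And>x y. x \<in> X \<Longrightarrow> y \<in> X \<Longrightarrow> q x y \<in> X"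
  shows "quandle X q"
proof -
  have FY: "F x \<in> Y" if "x \<in> X" for x
    using bij_betw_apply[OF F that] .
  have Fq: "F (q x y) = r (F x) (F y)" if "x \<in> X" "y \<in> X" for x y
    using hom that by (simp add: quandle_hom_def)
  have inj: "x = y" if "F x = F y" "x \<in> X" "y \<in> X" for x y
    using F that by (auto simp: bij_betw_def inj_on_def)
  have dist: "q (q x y) z = q (q x z) (q y z)" if "x \<in> X" "y \<in> X" "z \<in> X" for x y z
  proof (rule inj)
    have "r (r (F x) (F y)) (F z) = r (r (F x) (F z)) (r (F y) (F z))"
      using Y FY that unfolding quandle_def by blast
    then show "F (q (q x y) z) = F (q (q x z) (q y z))"
      using that closed by (simp only: Fq)
  qed (use that closed in auto)
  have idem: "q x x = x" if "x \<in> X" for x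
    by (rule inj) (use Y FY that closed in \<open>auto simp: Fq quandle_def\<close>)
  have bij_right: "bij_betw (\<lambda>y. q y x) X X" if x: "x \<in> X" for x
  proof -
    have "bij_betw ((\<lambda>y. r y (F x)) \<circ> F) X Y"
      using Y FY[OF x] by (intro bij_betw_trans[OF F]) (simp add: quandle_def)
    then have "bij_betw (F \<circ> (\<lambda>y. q y x)) X Y"
      using x by (subst bij_betw_cong[where g = "(\<lambda>y. r y (F x)) \<circ> F"]) (auto simp: Fq)
    then show ?thesis
      using closed x by (subst bij_betw_comp_iff2[OF F]) auto
  qed
  show ?thesis
    unfolding quandle_def
    by (intro conjI ballI; (rule closed | rule dist | rule idem | rule bij_right); assumption)
qed

text \<open>The algebra shared by the three cases. The map \<psi> is a parameter and not
  existentially quantified, since the topological and smooth cases must know that the isomorphism is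
  their own fibre coordinate.\<close>

lemma fiber_gauge_quandle_iso:
  assumes "group G" and act: "right_action P G act" and f: "equivariant P G act f"
    and S: "S \<subseteq> P" "\<And>p g. p \<in> S \<Longrightarrow> g \<in> carrier G \<Longrightarrow> act p g \<in> S"
    and \<psi>: "bij_betw \<psi> S (carrier G)"
      "\<And>p g. p \<in> S \<Longrightarrow> g \<in> carrier G \<Longrightarrow> \<psi> (act p g) = \<psi> p \<otimes>\<^bsub>G\<^esub> g"
  shows "\<exists>\<sigma>. inner_automorphism G \<sigma> \<and> quandle (carrier G) (gen_alexander G \<sigma>) \<and>
    quandle S (gauge_op G act f) \<and> quandle_hom S (gauge_op G act f) (gen_alexander G \<sigma>) \<psi>"
proof -
  interpret group G by fact
  obtain p0 where p0: "p0 \<in> S" "\<psi> p0 = \<one>\<^bsub>G\<^esub>"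
    using \<psi>(1) one_closed by (metis bij_betw_iff_bijections)
  define a where "a = f p0"
  have a: "a \<in> carrier G"
    using f p0 S(1) by (auto simp: equivariant_def a_def)
  have \<psi>G: "\<psi> p \<in> carrier G" if "p \<in> S" for p
    using bij_betw_apply[OF \<psi>(1) that] .
  \<comment> \<open>Both points lie in \<open>S\<close> and have the same value under \<psi>, which
    is injective there.\<close>
  have "act p0 (\<psi> p) = p" if "p \<in> S" for p
  proof -
    have "\<psi> (act p0 (\<psi> p)) = \<psi> p"
      using \<psi>(2)[OF p0(1) \<psi>G[OF that]] p0(2) \<psi>G[OF that] by simp
    then show ?thesis
      using \<psi>(1) S(2)[OF p0(1) \<psi>G[OF that]] that by (auto simp: bij_betw_def inj_on_def)
  qed
  then have fp: "f p = inv\<^bsub>G\<^esub> \<psi> p \<otimes>\<^bsub>G\<^esub> a \<otimes>\<^bsub>G\<^esub> \<psi> p" if "p \<in> S" for p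
    using f p0(1) S(1) \<psi>G[OF that] that unfolding equivariant_def a_def by (metis subsetD)
  \<comment> \<open>With \<open>u = \<psi> p\<close> and \<open>v = \<psi> q\<close>, the product
    \<open>u (f p)\<^sup>-\<^sup>1 (f q)\<close> is \<open>u (u\<^sup>-\<^sup>1 a u)\<^sup>-\<^sup>1
    (v\<^sup>-\<^sup>1 a v) = a\<^sup>-\<^sup>1 (u v\<^sup>-\<^sup>1) a v\<close>; this is where
    conjugation by the inverse of \<open>a\<close> comes from.\<close>
  define \<sigma> where "\<sigma> = (\<lambda>g\<in>carrier G. inv\<^bsub>G\<^esub> a \<otimes>\<^bsub>G\<^esub> g \<otimes>\<^bsub>G\<^esub> inv\<^bsub>G\<^esub> (inv\<^bsub>G\<^esub> a))"
  have \<sigma>: "inner_automorphism G \<sigma>"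
    unfolding \<sigma>_def by (rule conjugation_inner_automorphism[OF \<open>group G\<close> inv_closed[OF a]])
  have Q: "quandle (carrier G) (gen_alexander G \<sigma>)"
    using quandle_gen_alexander[OF \<open>group G\<close>] \<sigma> by (simp add: inner_automorphism_def)
  have fG: "f p \<in> carrier G" if "p \<in> S" for p
    using f S(1) that by (auto simp: equivariant_def)
  have closed: "gauge_op G act f p q \<in> S" if "p \<in> S" "q \<in> S" for p q
    using that fG S(2) by (simp add: gauge_op_def)
  have hom: "quandle_hom S (gauge_op G act f) (gen_alexander G \<sigma>) \<psi>"
    unfolding quandle_hom_def
  proof (intro ballI)
    fix p q assume p: "p \<in> S" and q: "q \<in> S"
    have cancel: "\<psi> p \<otimes>\<^bsub>G\<^esub> (inv\<^bsub>G\<^esub> \<psi> p \<otimes>\<^bsub>G\<^esub> x) = x" if "x \<in> carrier G" for x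
      using that \<psi>G[OF p] by (simp flip: m_assoc)
    have "\<psi> (gauge_op G act f p q) = \<psi> p \<otimes>\<^bsub>G\<^esub> (inv\<^bsub>G\<^esub> (f p) \<otimes>\<^bsub>G\<^esub> f q)"
      using \<psi>(2)[OF p] fG p q by (simp add: gauge_op_def)
    also have "\<dots> = gen_alexander G \<sigma> (\<psi> p) (\<psi> q)"
      using a \<psi>G[OF p] \<psi>G[OF q]
      by (simp add: fp[OF p] fp[OF q] gen_alexander_def \<sigma>_def inv_mult_group m_assoc cancel)
    finally show "\<psi> (gauge_op G act f p q) = gen_alexander G \<sigma> (\<psi> p) (\<psi> q)" .
  qed
  show ?thesis
    using \<sigma> Q hom quandle_transport[OF Q \<psi>(1) hom closed] by blast
qed

text \<open>A member of \<open>auto G\<close> carries no continuity or smoothness. Spelling \<sigma>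
  out as conjugation by a fixed element makes the operation a word in the group operations, which
  do.\<close>

lemma inner_automorphism_gen_alexander_eq:
  assumes "group G" "inner_automorphism G \<sigma>"
  obtains a where "a \<in> carrier G" "\<And>x y. x \<in> carrier G \<Longrightarrow> y \<in> carrier G \<Longrightarrow>
    a \<otimes>\<^bsub>G\<^esub> (x \<otimes>\<^bsub>G\<^esub> inv\<^bsub>G\<^esub> y) \<otimes>\<^bsub>G\<^esub> inv\<^bsub>G\<^esub> a \<otimes>\<^bsub>G\<^esub> y = gen_alexander G \<sigma> x y"
proof -
  interpret group G by fact
  obtain a where "a \<in> carrier G" "\<forall>g\<in>carrier G. \<sigma> g = a \<otimes>\<^bsub>G\<^esub> g \<otimes>\<^bsub>G\<^esub> inv\<^bsub>G\<^esub> a"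
    using assms(2) by (auto simp: inner_automorphism_def)
  then show ?thesis
    by (intro that[of a]) (auto simp: gen_alexander_def)
qed

section \<open>Continuity and smoothness of the quandle operations\<close>

lemma topological_group_mult:
  assumes "topological_group G T" "continuous_map X T f" "continuous_map X T g"
  shows "continuous_map X T (\<lambda>x. f x \<otimes>\<^bsub>G\<^esub> g x)"
  using continuous_map_compose[of X "prod_topology T T" "\<lambda>x. (f x, g x)" T "\<lambda>(x, y). x \<otimes>\<^bsub>G\<^esub> y"] assms
  by (simp add: topological_group_def continuous_map_pairwise o_def)

lemma topological_group_inv:
  assumes "topological_group G T" "continuous_map X T f"
  shows "continuous_map X T (\<lambda>x. inv\<^bsub>G\<^esub> f x)"
  using continuous_map_compose[OF assms(2), of T "\<lambda>x. inv\<^bsub>G\<^esub> x"] assms(1)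
  by (simp add: topological_group_def o_def)

lemma topological_quandle_gen_alexander:
  assumes G: "topological_group G T" and \<sigma>: "inner_automorphism G \<sigma>"
    and Q: "quandle (carrier G) (gen_alexander G \<sigma>)"
  shows "topological_quandle T (gen_alexander G \<sigma>)"
proof -
  have top: "topspace T = carrier G" and "group G"
    using G by (simp_all add: topological_group_def)
  obtain a where a: "a \<in> carrier G" "\<And>x y. x \<in> carrier G \<Longrightarrow> y \<in> carrier G \<Longrightarrow>
    a \<otimes>\<^bsub>G\<^esub> (x \<otimes>\<^bsub>G\<^esub> inv\<^bsub>G\<^esub> y) \<otimes>\<^bsub>G\<^esub> inv\<^bsub>G\<^esub> a \<otimes>\<^bsub>G\<^esub> y = gen_alexander G \<sigma> x y"
    by (rule inner_automorphism_gen_alexander_eq[OF \<open>group G\<close> \<sigma>]) blast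
  have "continuous_map (prod_topology T T) T
      (\<lambda>p. a \<otimes>\<^bsub>G\<^esub> (fst p \<otimes>\<^bsub>G\<^esub> inv\<^bsub>G\<^esub> snd p) \<otimes>\<^bsub>G\<^esub> inv\<^bsub>G\<^esub> a \<otimes>\<^bsub>G\<^esub> snd p)"
    by (intro topological_group_mult[OF G] topological_group_inv[OF G]
          continuous_map_fst continuous_map_snd) (simp_all add: a(1) top)
  then have "continuous_map (prod_topology T T) T (\<lambda>(x, y). gen_alexander G \<sigma> x y)"
    by (rule continuous_map_eq) (auto simp: top a(2))
  then show ?thesis
    using Q by (simp add: topological_quandle_def top)
qed

text \<open>On \<open>S\<close> the operation \<open>q\<close> is the composite of \<open>F\<close>
  in both arguments, \<open>r\<close>, and the inverse of \<open>F\<close>, so it inherits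
  continuity from \<open>r\<close>.\<close>

lemma topological_quandle_transport:
  assumes T: "topological_quandle T r" and F: "homeomorphic_map S T F"
    and hom: "quandle_hom (topspace S) q r F" and Q: "quandle (topspace S) q"
  shows "topological_quandle S q"
proof -
  obtain s where s: "homeomorphic_maps S T F s"
    using F homeomorphic_map_maps by blast
  then have cF: "continuous_map S T F" and cs: "continuous_map T S s"
    and sF: "\<And>x. x \<in> topspace S \<Longrightarrow> s (F x) = x"
    by (auto simp: homeomorphic_maps_def)
  have "continuous_map (prod_topology S S) (prod_topology T T) (\<lambda>p. (F (fst p), F (snd p)))"
    using continuous_map_compose[OF continuous_map_fst cF, of S] continuous_map_compose[OF continuous_map_snd cF, of S]
    by (simp add: continuous_map_pairwise o_def)
  moreover have "continuous_map (prod_topology T T) T (\<lambda>(x, y). r x y)"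
    using T by (simp add: topological_quandle_def)
  ultimately have "continuous_map (prod_topology S S) S (s \<circ> ((\<lambda>(x, y). r x y) \<circ> (\<lambda>p. (F (fst p), F (snd p)))))"
    by (rule continuous_map_compose[OF continuous_map_compose cs])
  then have "continuous_map (prod_topology S S) S (\<lambda>(x, y). q x y)"
  proof (rule continuous_map_eq)
    fix p assume "p \<in> topspace (prod_topology S S)"
    then obtain x y where p: "p = (x, y)" "x \<in> topspace S" "y \<in> topspace S" by auto
    then have "r (F x) (F y) = F (q x y)" "q x y \<in> topspace S"
      using hom Q by (auto simp: quandle_hom_def quandle_def)
    then show "(s \<circ> ((\<lambda>(x, y). r x y) \<circ> (\<lambda>p. (F (fst p), F (snd p))))) p = (case p of (x, y) \<Rightarrow> q x y)"
      by (simp add: p sF)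
  qed
  then show ?thesis
    using Q by (simp add: topological_quandle_def)
qed

lemma lie_group_mult:
  assumes G: "lie_group G A" and X: "has_atlas X" and "smooth_map X A f" "smooth_map X A g"
  shows "smooth_map X A (\<lambda>x. f x \<otimes>\<^bsub>G\<^esub> g x)"
proof -
  have A: "has_atlas A" using G by (simp add: lie_group_def smooth_manifold_has_atlas)
  have "smooth_map (prod_mfd A A) A (\<lambda>(x, y). x \<otimes>\<^bsub>G\<^esub> y)"
    using G by (simp add: lie_group_def)
  from smooth_map_compose[OF X has_atlas_prod[OF A A] A smooth_map_Pair[OF X A A assms(3,4)] this]
  show ?thesis by simp
qed

lemma lie_group_inv:
  assumes G: "lie_group G A" and X: "has_atlas X" and "smooth_map X A f"
  shows "smooth_map X A (\<lambda>x. inv\<^bsub>G\<^esub> f x)"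
proof -
  have A: "has_atlas A" using G by (simp add: lie_group_def smooth_manifold_has_atlas)
  show ?thesis
    by (rule smooth_map_compose[OF X A A assms(3)]) (use G in \<open>simp add: lie_group_def\<close>)
qed

lemma smooth_quandle_gen_alexander:
  assumes G: "lie_group G A" and \<sigma>: "inner_automorphism G \<sigma>"
    and Q: "quandle (carrier G) (gen_alexander G \<sigma>)"
  shows "smooth_quandle A (gen_alexander G \<sigma>)"
proof -
  have top: "topspace (mtop A) = carrier G" and "group G" and A: "smooth_manifold A"
    using G by (simp_all add: lie_group_def)
  note At = smooth_manifold_has_atlas[OF A]
  note AA = has_atlas_prod[OF At At]
  obtain a where a: "a \<in> carrier G" "\<And>x y. x \<in> carrier G \<Longrightarrow> y \<in> carrier G \<Longrightarrow>
    a \<otimes>\<^bsub>G\<^esub> (x \<otimes>\<^bsub>G\<^esub> inv\<^bsub>G\<^esub> y) \<otimes>\<^bsub>G\<^esub> inv\<^bsub>G\<^esub> a \<otimes>\<^bsub>G\<^esub> y = gen_alexander G \<sigma> x y"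
    by (rule inner_automorphism_gen_alexander_eq[OF \<open>group G\<close> \<sigma>]) blast
  have "smooth_map (prod_mfd A A) A
      (\<lambda>p. a \<otimes>\<^bsub>G\<^esub> (fst p \<otimes>\<^bsub>G\<^esub> inv\<^bsub>G\<^esub> snd p) \<otimes>\<^bsub>G\<^esub> inv\<^bsub>G\<^esub> a \<otimes>\<^bsub>G\<^esub> snd p)"
    by (intro lie_group_mult[OF G AA] lie_group_inv[OF G AA] smooth_map_const[OF AA At]
          smooth_map_fst[OF A At] smooth_map_snd[OF At A]) (simp_all add: a(1) top)
  then have "smooth_map (prod_mfd A A) A (\<lambda>(x, y). gen_alexander G \<sigma> x y)"
    by (rule smooth_map_cong[OF AA At]) (auto simp: prod_mfd_def top a(2))
  then show ?thesis
    using Q A by (simp add: smooth_quandle_def top)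
qed

text \<open>The same factorization of \<open>q\<close> through \<open>r\<close> as in the
  topological case. That \<open>A\<close> is a manifold is a separate assumption because
  \<open>diffeomorphism\<close> does not assert it.\<close>

lemma smooth_quandle_transport:
  assumes B: "smooth_quandle B r" and A: "smooth_manifold A" and F: "diffeomorphism A B F"
    and hom: "quandle_hom (topspace (mtop A)) q r F" and Q: "quandle (topspace (mtop A)) q"
  shows "smooth_quandle A q"
proof -
  define s where "s = inv_into (topspace (mtop A)) F"
  have sF: "s (F x) = x" if "x \<in> topspace (mtop A)" for x
    using F that by (auto simp: s_def diffeomorphism_def bij_betw_def)
  have mF: "smooth_map A B F" and ms: "smooth_map B A s"
    using F by (simp_all add: s_def diffeomorphism_def)
  have B': "smooth_manifold B" and r: "smooth_map (prod_mfd B B) B (\<lambda>(x, y). r x y)"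
    using B by (simp_all add: smooth_quandle_def)
  note At = smooth_manifold_has_atlas[OF A] and Bt = smooth_manifold_has_atlas[OF B']
  note AA = has_atlas_prod[OF At At] and BB = has_atlas_prod[OF Bt Bt]
  have "smooth_map (prod_mfd A A) (prod_mfd B B) (\<lambda>p. (F (fst p), F (snd p)))"
    by (intro smooth_map_Pair[OF AA Bt Bt] smooth_map_compose[OF AA At Bt _ mF]
          smooth_map_fst[OF A At] smooth_map_snd[OF At A])
  from smooth_map_compose[OF AA Bt At smooth_map_compose[OF AA BB Bt this r] ms]
  have "smooth_map (prod_mfd A A) A (\<lambda>p. s (r (F (fst p)) (F (snd p))))"
    by simp
  then have "smooth_map (prod_mfd A A) A (\<lambda>(x, y). q x y)"
  proof (rule smooth_map_cong[OF AA At])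
    fix p assume "p \<in> topspace (mtop (prod_mfd A A))"
    then obtain x y where p: "p = (x, y)" "x \<in> topspace (mtop A)" "y \<in> topspace (mtop A)"
      by (auto simp: prod_mfd_def)
    then have "r (F x) (F y) = F (q x y)" "q x y \<in> topspace (mtop A)"
      using hom Q by (auto simp: quandle_hom_def quandle_def)
    then show "s (r (F (fst p)) (F (snd p))) = (case p of (x, y) \<Rightarrow> q x y)"
      by (simp add: p sF)
  qed
  then show ?thesis
    using Q A by (simp add: smooth_quandle_def)
qed

section \<open>Fibres of gauge quandles\<close>

lemma discrete_fiber_gauge_quandle:
  assumes "discrete_gauge_quandle P M G \<pi> act f" "m \<in> M"
  shows "\<exists>\<sigma>. inner_automorphism G \<sigma> \<and>
    quandle_isomorphic (fiber P \<pi> m) (gauge_op G act f) (carrier G) (gen_alexander G \<sigma>)"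
proof -
  have B: "discrete_principal_bundle P M G \<pi> act" and f: "equivariant P G act f"
    using assms(1) by (auto simp: discrete_gauge_quandle_def)
  then have G: "group G" and act: "right_action P G act"
    and \<pi>: "\<And>p g. p \<in> P \<Longrightarrow> g \<in> carrier G \<Longrightarrow> \<pi> (act p g) = \<pi> p"
    by (auto simp: discrete_principal_bundle_def)
  have "\<exists>\<psi>. bij_betw \<psi> (fiber P \<pi> m) (carrier G) \<and>
      (\<forall>p \<in> fiber P \<pi> m. \<forall>g \<in> carrier G. \<psi> (act p g) = \<psi> p \<otimes>\<^bsub>G\<^esub> g)"
    using B assms(2) by (simp add: discrete_principal_bundle_def)
  then obtain \<psi> where \<psi>: "bij_betw \<psi> (fiber P \<pi> m) (carrier G)"
    "\<And>p g. p \<in> fiber P \<pi> m \<Longrightarrow> g \<in> carrier G \<Longrightarrow> \<psi> (act p g) = \<psi> p \<otimes>\<^bsub>G\<^esub> g"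
    by blast
  have "act p g \<in> fiber P \<pi> m" if "p \<in> fiber P \<pi> m" "g \<in> carrier G" for p g
    using that act \<pi> by (auto simp: fiber_def right_action_def)
  from fiber_gauge_quandle_iso[OF G act f _ this \<psi>] show ?thesis
    using \<psi>(1) by (auto simp: quandle_isomorphic_def fiber_def)
qed

lemma topological_fiber_gauge_quandle:
  assumes "topological_gauge_quandle P M G T \<pi> act f" "m \<in> topspace M"
  shows "\<exists>\<sigma>. inner_automorphism G \<sigma> \<and>
    topological_quandle_isomorphic (subtopology P (fiber (topspace P) \<pi> m)) (gauge_op G act f)
      T (gen_alexander G \<sigma>)"
proof -
  define S where "S = fiber (topspace P) \<pi> m"
  have B: "topological_principal_bundle P M G T \<pi> act" and f: "equivariant (topspace P) G act f"
    using assms(1) by (auto simp: topological_gauge_quandle_def)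
  then have G: "topological_group G T" and act: "right_action (topspace P) G act"
    and \<pi>: "\<And>p g. p \<in> topspace P \<Longrightarrow> g \<in> carrier G \<Longrightarrow> \<pi> (act p g) = \<pi> p"
    by (auto simp: topological_principal_bundle_def)
  then have "group G" and top: "topspace T = carrier G"
    by (simp_all add: topological_group_def)
  have "\<exists>U \<psi>. openin M U \<and> m \<in> U \<and>
      homeomorphic_map (subtopology P {p \<in> topspace P. \<pi> p \<in> U})
        (prod_topology (subtopology M U) T) (\<lambda>p. (\<pi> p, \<psi> p)) \<and>
      (\<forall>p \<in> topspace P. \<pi> p \<in> U \<longrightarrow> (\<forall>g \<in> carrier G. \<psi> (act p g) = \<psi> p \<otimes>\<^bsub>G\<^esub> g))"
    using B assms(2) by (simp add: topological_principal_bundle_def)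
  then obtain U \<psi> where U: "openin M U" "m \<in> U"
    and hm: "homeomorphic_map (subtopology P {p \<in> topspace P. \<pi> p \<in> U})
          (prod_topology (subtopology M U) T) (\<lambda>p. (\<pi> p, \<psi> p))"
    and eq: "\<And>p g. p \<in> topspace P \<Longrightarrow> \<pi> p \<in> U \<Longrightarrow> g \<in> carrier G \<Longrightarrow> \<psi> (act p g) = \<psi> p \<otimes>\<^bsub>G\<^esub> g"
    by blast
  let ?O = "{p \<in> topspace P. \<pi> p \<in> U}"
  obtain k where k: "homeomorphic_maps (subtopology P ?O) (prod_topology (subtopology M U) T) (\<lambda>p. (\<pi> p, \<psi> p)) k"
    using hm homeomorphic_map_maps by blast
  have SO: "S \<subseteq> ?O" using U(2) by (auto simp: S_def fiber_def)
  have Utop: "U \<subseteq> topspace M" using openin_subset[OF U(1)] .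
  have kO: "k (m, g) \<in> ?O" and km: "\<pi> (k (m, g)) = m" "\<psi> (k (m, g)) = g" if "g \<in> carrier G" for g
  proof -
    have mg: "(m, g) \<in> topspace (prod_topology (subtopology M U) T)"
      using that U(2) Utop top by auto
    show "k (m, g) \<in> ?O"
      using k continuous_map_image_subset_topspace mg unfolding homeomorphic_maps_def by fastforce
    show "\<pi> (k (m, g)) = m" "\<psi> (k (m, g)) = g"
      using k mg unfolding homeomorphic_maps_def by fastforce+
  qed
  \<comment> \<open>A continuous bijection would not suffice, so an inverse is exhibited: the slice
    map into the product at the fixed base point \<open>m\<close>, followed by \<open>k\<close>. It
    lands in \<open>S\<close> because \<open>k (m, g)\<close> projects to \<open>m\<close>.\<close>
  have "homeomorphic_maps (subtopology P S) T \<psi> (\<lambda>g. k (m, g))"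
    unfolding homeomorphic_maps_def
  proof (intro conjI ballI)
    have "continuous_map (subtopology P ?O) T \<psi>"
      using k by (simp add: homeomorphic_maps_def continuous_map_pairwise o_def)
    then show "continuous_map (subtopology P S) T \<psi>"
      using continuous_map_from_subtopology_mono SO by blast
    have "continuous_map T (prod_topology (subtopology M U) T) (\<lambda>g. (m, g))"
      using U(2) Utop by (auto simp: continuous_map_pairwise o_def)
    moreover have "continuous_map (prod_topology (subtopology M U) T) P k"
      using k continuous_map_into_fulltopology unfolding homeomorphic_maps_def by blast
    ultimately have "continuous_map T P (\<lambda>g. k (m, g))"
      using continuous_map_compose[of T "prod_topology (subtopology M U) T" "\<lambda>g. (m, g)" P k] by (simp add: o_def)
    then show "continuous_map T (subtopology P S) (\<lambda>g. k (m, g))"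
      using kO km top by (auto simp: continuous_map_in_subtopology S_def fiber_def)
    show "k (m, \<psi> p) = p" if "p \<in> topspace (subtopology P S)" for p
    proof -
      have "p \<in> topspace (subtopology P ?O)" "\<pi> p = m"
        using that SO by (auto simp: S_def fiber_def)
      then show ?thesis using k by (auto simp: homeomorphic_maps_def)
    qed
    show "\<psi> (k (m, g)) = g" if "g \<in> topspace T" for g
      using km that top by simp
  qed
  then have hS: "homeomorphic_map (subtopology P S) T \<psi>"
    using homeomorphic_maps_imp_map by blast
  have topS: "topspace (subtopology P S) = S" by (auto simp: S_def fiber_def)
  have bij: "bij_betw \<psi> S (carrier G)"
    using homeomorphic_imp_injective_map[OF hS] homeomorphic_imp_surjective_map[OF hS] topS top
    by (simp add: bij_betw_def)
  have actS: "act p g \<in> S" if "p \<in> S" "g \<in> carrier G" for p g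
    using that act \<pi> by (auto simp: S_def fiber_def right_action_def)
  have eqS: "\<psi> (act p g) = \<psi> p \<otimes>\<^bsub>G\<^esub> g" if "p \<in> S" "g \<in> carrier G" for p g
    using eq SO that by blast
  have SP: "S \<subseteq> topspace P" by (auto simp: S_def fiber_def)
  obtain \<sigma> where \<sigma>: "inner_automorphism G \<sigma>" and Q: "quandle (carrier G) (gen_alexander G \<sigma>)"
    "quandle S (gauge_op G act f)" and hom: "quandle_hom S (gauge_op G act f) (gen_alexander G \<sigma>) \<psi>"
    using fiber_gauge_quandle_iso[OF \<open>group G\<close> act f SP actS bij eqS] by blast
  note TQ = topological_quandle_gen_alexander[OF G \<sigma> Q(1)]
  have "topological_quandle (subtopology P S) (gauge_op G act f)"
    using topological_quandle_transport[OF TQ hS] hom Q(2) topS by simp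
  then show ?thesis
    using \<sigma> TQ hS hom topS unfolding topological_quandle_isomorphic_def
    by (intro exI[of _ \<sigma>]) (auto simp flip: S_def)
qed

text \<open>Unlike the subspace topology, the smooth structure on the fibre is not known in advance
  to be one: that \<open>fiber_mfd\<close> is a manifold is part of the claim, and it is obtained
  together with the diffeomorphism.\<close>

lemma smooth_fiber_gauge_quandle:
  assumes "smooth_gauge_quandle P M G A \<pi> act f" "m \<in> topspace (mtop M)"
  shows "\<exists>\<sigma>. inner_automorphism G \<sigma> \<and>
    smooth_quandle_isomorphic (fiber_mfd P A \<pi> m) (gauge_op G act f) A (gen_alexander G \<sigma>)"
proof -
  define S where "S = fiber (topspace (mtop P)) \<pi> m"
  have B: "smooth_principal_bundle P M G A \<pi> act" and f: "equivariant (topspace (mtop P)) G act f"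
    using assms(1) by (auto simp: smooth_gauge_quandle_def)
  then have P: "smooth_manifold P" and M: "smooth_manifold M" and G: "lie_group G A"
    and act: "right_action (topspace (mtop P)) G act" and m\<pi>: "smooth_map P M \<pi>"
    and \<pi>: "\<And>p g. p \<in> topspace (mtop P) \<Longrightarrow> g \<in> carrier G \<Longrightarrow> \<pi> (act p g) = \<pi> p"
    by (auto simp: smooth_principal_bundle_def)
  then have "group G" and top: "topspace (mtop A) = carrier G" and A: "smooth_manifold A"
    by (simp_all add: lie_group_def)
  have "\<exists>U \<psi>. openin (mtop M) U \<and> m \<in> U \<and>
      diffeomorphism (open_submfd P {p \<in> topspace (mtop P). \<pi> p \<in> U})
        (prod_mfd (open_submfd M U) A) (\<lambda>p. (\<pi> p, \<psi> p)) \<and>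
      (\<forall>p \<in> topspace (mtop P). \<pi> p \<in> U \<longrightarrow>
         (\<forall>g \<in> carrier G. \<psi> (act p g) = \<psi> p \<otimes>\<^bsub>G\<^esub> g))"
    using B assms(2) by (simp add: smooth_principal_bundle_def)
  then obtain U \<psi> where U: "openin (mtop M) U" "m \<in> U"
    and df: "diffeomorphism (open_submfd P {p \<in> topspace (mtop P). \<pi> p \<in> U})
          (prod_mfd (open_submfd M U) A) (\<lambda>p. (\<pi> p, \<psi> p))"
    and eq: "\<And>p g. p \<in> topspace (mtop P) \<Longrightarrow> \<pi> p \<in> U \<Longrightarrow> g \<in> carrier G \<Longrightarrow> \<psi> (act p g) = \<psi> p \<otimes>\<^bsub>G\<^esub> g"
    by blast
  let ?O = "{p \<in> topspace (mtop P). \<pi> p \<in> U}" and ?\<Phi> = "\<lambda>p. (\<pi> p, \<psi> p)"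
  have O1: "openin (mtop P) ?O"
    using openin_continuous_map_preimage[OF smooth_map_continuous[OF m\<pi>] U(1)] .
  have topO: "topspace (mtop (open_submfd P ?O)) = ?O"
    by (auto simp: open_submfd_def)
  note Pt = smooth_manifold_has_atlas[OF P] and Mt = smooth_manifold_has_atlas[OF M]
    and At = smooth_manifold_has_atlas[OF A]
  note POt = has_atlas_open_submfd[OF Pt O1] and MUt = has_atlas_open_submfd[OF Mt U(1)]
  note prt = has_atlas_prod[OF MUt At]
  have Utop: "U \<subseteq> topspace (mtop M)" using openin_subset[OF U(1)] .
  have topprod: "topspace (mtop (prod_mfd (open_submfd M U) A)) = U \<times> carrier G"
    using Utop top by (auto simp: prod_mfd_def open_submfd_def)
  define k where "k = inv_into ?O ?\<Phi>"
  have bij\<Phi>: "bij_betw ?\<Phi> ?O (U \<times> carrier G)" and m\<Phi>: "smooth_map (open_submfd P ?O) (prod_mfd (open_submfd M U) A) ?\<Phi>"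
    and mk: "smooth_map (prod_mfd (open_submfd M U) A) (open_submfd P ?O) k"
    using df by (simp_all add: diffeomorphism_def topO topprod k_def)
  have SO: "S \<subseteq> ?O" using U(2) by (auto simp: S_def fiber_def)
  have kO: "k (m, g) \<in> ?O" and km: "\<pi> (k (m, g)) = m" "\<psi> (k (m, g)) = g" if "g \<in> carrier G" for g
  proof -
    have "(m, g) \<in> ?\<Phi> ` ?O"
      using bij_betw_imp_surj_on[OF bij\<Phi>] that U(2) by simp
    from inv_into_into[OF this] f_inv_into_f[OF this]
    show "k (m, g) \<in> ?O" "\<pi> (k (m, g)) = m" "\<psi> (k (m, g)) = g"
      by (simp_all add: k_def)
  qed
  have kS: "k (m, g) \<in> S \<and> \<psi> (k (m, g)) = g" if "g \<in> topspace (mtop A)" for g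
    using kO[of g] km[of g] that top by (simp add: S_def fiber_def)
  have k\<psi>: "k (m, \<psi> p) = p" if "p \<in> S" for p
  proof -
    have "p \<in> ?O" "\<pi> p = m" using that SO by (auto simp: S_def fiber_def)
    then show ?thesis
      using inv_into_f_f[OF bij_betw_imp_inj_on[OF bij\<Phi>], of p] by (simp add: k_def)
  qed
  have mMU: "m \<in> topspace (mtop (open_submfd M U))"
    using U(2) Utop by (auto simp: open_submfd_def)
  \<comment> \<open>The trivialization gives \<open>k\<close> as a map into an open piece of
    \<open>P\<close>; the parametrization of the fibre must be smooth into \<open>P\<close>
    itself.\<close>
  have "smooth_map (prod_mfd (open_submfd M U) A) P k"
  proof -
    have "k z \<in> ?O" if "z \<in> topspace (mtop (prod_mfd (open_submfd M U) A))" for z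
      using smooth_map_image[OF mk that] topO by simp
    then show ?thesis
      using mk smooth_map_into_open_submfd[OF prt, of k ?O P] by simp
  qed
  moreover have "smooth_map A (prod_mfd (open_submfd M U) A) (\<lambda>g. (m, g))"
    by (rule smooth_map_Pair[OF At MUt At smooth_map_const[OF At MUt mMU] smooth_map_id[OF A]])
  ultimately have ms: "smooth_map A P (\<lambda>g. k (m, g))"
    using smooth_map_compose[OF At prt Pt] by blast
  have m\<psi>: "smooth_map (open_submfd P ?O) A \<psi>"
    using smooth_map_compose[OF POt prt At m\<Phi> smooth_map_snd[OF MUt A]] by simp
  let ?F = "embedded_submfd P S (mdim A)"
  \<comment> \<open>The slice of \<open>k\<close> at \<open>m\<close> serves as the parametrization
    \<open>s\<close>, and the trivialized open set as the neighbourhood of the fibre on which \<psi>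
    is smooth.\<close>
  have F: "smooth_manifold ?F" and d\<psi>: "diffeomorphism ?F A \<psi>"
    using embedded_submfd_diffeomorphism[OF P A O1 SO m\<psi> ms kS k\<psi>] by blast+
  have topS: "topspace (mtop ?F) = S" by (auto simp: S_def fiber_def)
  have bij: "bij_betw \<psi> S (carrier G)"
    using d\<psi> topS top by (simp add: diffeomorphism_def)
  have actS: "act p g \<in> S" if "p \<in> S" "g \<in> carrier G" for p g
    using that act \<pi> by (auto simp: S_def fiber_def right_action_def)
  have eqS: "\<psi> (act p g) = \<psi> p \<otimes>\<^bsub>G\<^esub> g" if "p \<in> S" "g \<in> carrier G" for p g
    using eq SO that by blast
  have SP: "S \<subseteq> topspace (mtop P)" by (auto simp: S_def fiber_def)
  obtain \<sigma> where \<sigma>: "inner_automorphism G \<sigma>" and Q: "quandle (carrier G) (gen_alexander G \<sigma>)"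
    "quandle S (gauge_op G act f)" and hom: "quandle_hom S (gauge_op G act f) (gen_alexander G \<sigma>) \<psi>"
    using fiber_gauge_quandle_iso[OF \<open>group G\<close> act f SP actS bij eqS] by blast
  note SQ = smooth_quandle_gen_alexander[OF G \<sigma> Q(1)]
  have "smooth_quandle ?F (gauge_op G act f)"
    using smooth_quandle_transport[OF SQ F d\<psi>] hom Q(2) topS by simp
  then show ?thesis
    using \<sigma> SQ d\<psi> hom topS unfolding smooth_quandle_isomorphic_def fiber_mfd_def
    by (intro exI[of _ \<sigma>]) (auto simp flip: S_def)
qed

theorem proposition10:
  fixes G :: "('g, 'c) monoid_scheme"
    and \<pi> :: "'p \<Rightarrow> 'm" and act :: "'p \<Rightarrow> 'g \<Rightarrow> 'p" and f :: "'p \<Rightarrow> 'g"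
    and P :: "'p set" and M :: "'m set"
    and TP :: "'p topology" and TM :: "'m topology" and TG :: "'g topology"
    and AP :: "'p mfd" and AM :: "'m mfd" and AG :: "'g mfd"
  shows
    "(discrete_gauge_quandle P M G \<pi> act f \<longrightarrow>
        (\<forall>m\<in>M. \<exists>\<sigma>. inner_automorphism G \<sigma> \<and>
           quandle_isomorphic (fiber P \<pi> m) (gauge_op G act f)
             (carrier G) (gen_alexander G \<sigma>)))
   \<and> (topological_gauge_quandle TP TM G TG \<pi> act f \<longrightarrow>
        (\<forall>m\<in>topspace TM. \<exists>\<sigma>. inner_automorphism G \<sigma> \<and>
           topological_quandle_isomorphic
             (subtopology TP (fiber (topspace TP) \<pi> m)) (gauge_op G act f)
             TG (gen_alexander G \<sigma>)))
   \<and> (smooth_gauge_quandle AP AM G AG \<pi> act f \<longrightarrow>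
        (\<forall>m\<in>topspace (mtop AM). \<exists>\<sigma>. inner_automorphism G \<sigma> \<and>
           smooth_quandle_isomorphic
             (fiber_mfd AP AG \<pi> m) (gauge_op G act f)
             AG (gen_alexander G \<sigma>)))"
  by (intro conjI impI ballI;
      (rule discrete_fiber_gauge_quandle | rule topological_fiber_gauge_quandle
        | rule smooth_fiber_gauge_quandle); assumption)

end
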